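(* Let $0<r<1$, $k=\sqrt{1-r^2}$ and $q=e^{-\pi K(r)/K(k)}$. Let $\Phi_r(u)=\operatorname{dn}(K(k)\arccos(u)/\pi,k)$. Among all $\varphi_r\in\mathcal{F}_r$ with $\rho_{\mathrm A}[\varphi_r]>1$, the maximum value of $\hat\rho[\varphi_r]$ is attained if and only if $\varphi_r(u)=\Phi_r(u)$ on $\mathbb{E}_{q^{-1}}$, and $$\hat\rho[\Phi_r]=\rho_{\mathrm A}[\Phi_r]=q^{-1}=e^{\pi K(r)/K(k)}=e^{\pi K(r)/K(\sqrt{1-r^2})}.$$
   Context: $K(k)=\int_0^{\pi/2}(1-k^2\sin^2\theta)^{-1/2}d\theta$ is the complete elliptic integral of the first kind with modulus $k$, and $\operatorname{dn}(\cdot,k)$ is Jacobi's delta amplitude function with modulus $k$. $\Phi_r$ is the single-valued meromorphic function on $\mathbb{C}$ determined by $\Phi_r(\cos z)=\operatorname{dn}(K(k)z/\pi,k)$, $z\in\mathbb{C}$ (well defined because $\operatorname{dn}(\cdot,k)$ is even and $2K(k)$-periodic). For $1<\rho<\infty$ the open Bernstein ellipse is $\mathbb{E}_\rho=\{z\in\mathbb{C}:\frac{(\operatorname{Re}z)^2}{((\rho+\rho^{-1})/2)^2}+\frac{(\operatorname{Im}z)^2}{((\rho-\rho^{-1})/2)^2}<1\}$, with boundary $\mathrm{bd}(\mathbb{E}_\rho)$; $\mathbb{E}_\infty=\mathbb{C}$. For $0<r<1$, $\mathcal{F}_r$ is the set of real functions $\varphi_r$ on $[-1,1]$ that are continuous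 and strictly increasing with $\varphi_r(-1)=r$, $\varphi_r(1)=1$. For $F:[-1,1]\to\mathbb{R}$, $\rho_{\mathrm A}[F]\in[1,\infty]$ is: $1$ if $F$ is not analytic at some point of $[-1,1]$; $\rho\in(1,\infty)$ if $F$ extends analytically to $\mathbb{E}_\rho$ and the extension is not analytic at some point of $\mathrm{bd}(\mathbb{E}_\rho)$; $\infty$ if $F$ extends to an entire function. When $\rho_{\mathrm A}[\varphi_r]>1$, $\varphi_r$ also denotes its analytic continuation to $\mathbb{E}_{\rho_{\mathrm A}[\varphi_r]}$. For $\varphi_r\in\mathcal{F}_r$ with $\rho_{\mathrm A}[\varphi_r]>1$ put $m=\inf_{u\in\mathbb{E}_{\rho_{\mathrm A}[\varphi_r]}}\operatorname{Re}\varphi_r(u)\in[-\infty,\infty)$. If $m<0$, $\rho_0[\varphi_r]$ denotes the unique number in $(1,\rho_{\mathrm A}[\varphi_r])$ with $\inf_{u\in\mathbb{E}_{\rho_0[\varphi_r]}}\operatorname{Re}\varphi_r(u)=0$. Define $\hat\rho[\varphi_r]=\rho_{\mathrm A}[\varphi_r]$ if $m\ge0$ and $\hat\rho[\varphi_r]=\rho_0[\varphi_r]$ if $m<0$. *)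

theory Defs
  imports "HOL-Complex_Analysis.Complex_Analysis"
begin

section \<open>Elliptic integrals and the delta amplitude\<close>

definition ellipF :: "real \<Rightarrow> real \<Rightarrow> real" where
  "ellipF k \<phi> = (LBINT \<theta>=ereal 0..ereal \<phi>. 1 / sqrt (1 - k\<^sup>2 * (sin \<theta>)\<^sup>2))"

definition ellipK :: "real \<Rightarrow> real" where
  "ellipK k = (LBINT \<theta>=ereal 0..ereal (pi / 2). 1 / sqrt (1 - k\<^sup>2 * (sin \<theta>)\<^sup>2))"

text \<open>For \<open>0 \<le> k < 1\<close>, \<open>ellipF k\<close> is an increasing bijection of the real line, so the
  amplitude is well defined.\<close>

definition jacobi_am :: "real \<Rightarrow> real \<Rightarrow> real" where
  "jacobi_am k u = (THE \<phi>. ellipF k \<phi> = u)"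

text \<open>The delta amplitude is \<open>sqrt (1 - k\<^sup>2 sin\<^sup>2 (am u))\<close> for real \<open>u\<close>, and its meromorphic
  continuation for complex \<open>u\<close>. The predicate \<open>nicely_meromorphic_on\<close> excludes removable
  singularities and fixes the value 0 at poles, so that the continuation is unique as a total
  function.\<close>

definition jacobi_dn :: "real \<Rightarrow> complex \<Rightarrow> complex" where
  "jacobi_dn k = (THE f. f nicely_meromorphic_on UNIV \<and>
     (\<forall>u::real. f (of_real u) = of_real (sqrt (1 - k\<^sup>2 * (sin (jacobi_am k u))\<^sup>2))))"

text \<open>Since \<open>cos (Arccos u) = u\<close>, and \<open>dn\<close> is even and has period \<open>2 K(k)\<close>, this is the function
  determined by \<open>\<Phi>\<^sub>r (cos z) = dn (K(k) z / \<pi>, k)\<close>; the branch of the arccosine is irrelevant.\<close>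

definition Phi :: "real \<Rightarrow> complex \<Rightarrow> complex" where
  "Phi r u = (let k = sqrt (1 - r\<^sup>2) in
     jacobi_dn k (of_real (ellipK k) * Arccos u / of_real pi))"

section \<open>Bernstein ellipses and analytic continuation\<close>

definition bernstein_ellipse :: "ereal \<Rightarrow> complex set" where
  "bernstein_ellipse \<rho> = (if \<rho> = \<infinity> then UNIV else
     (let R = real_of_ereal \<rho> in
       {z. (Re z)\<^sup>2 / ((R + inverse R) / 2)\<^sup>2 + (Im z)\<^sup>2 / ((R - inverse R) / 2)\<^sup>2 < 1}))"

text \<open>\<open>g\<close>, considered as a function on \<open>S\<close> only, is analytic at \<open>z\<close>, where \<open>z\<close> lies in \<open>S\<close> or on
  its boundary.\<close>

definition analytic_at_rel :: "(complex \<Rightarrow> complex) \<Rightarrow> complex set \<Rightarrow> complex \<Rightarrow> bool" where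
  "analytic_at_rel g S z \<longleftrightarrow>
     (\<exists>\<epsilon>>0. \<exists>h. h holomorphic_on ball z \<epsilon> \<and> (\<forall>w\<in>ball z \<epsilon> \<inter> S. h w = g w))"

text \<open>Functions on \<open>[-1,1]\<close> are represented by total functions on the reals; values outside
  \<open>[-1,1]\<close> are never used.\<close>

definition analytic_at_pt :: "(real \<Rightarrow> real) \<Rightarrow> real \<Rightarrow> bool" where
  "analytic_at_pt F x \<longleftrightarrow>
     analytic_at_rel (\<lambda>w. of_real (F (Re w))) (of_real ` {-1..1}) (of_real x)"

definition extends_to :: "(real \<Rightarrow> real) \<Rightarrow> (complex \<Rightarrow> complex) \<Rightarrow> ereal \<Rightarrow> bool" where
  "extends_to F g \<rho> \<longleftrightarrow> g holomorphic_on bernstein_ellipse \<rho> \<and>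
     (\<forall>x\<in>{-1..1}. g (of_real x) = of_real (F x))"

definition rho_A :: "(real \<Rightarrow> real) \<Rightarrow> ereal" where
  "rho_A F =
     (if \<exists>x\<in>{-1..1}. \<not> analytic_at_pt F x then 1
      else if \<exists>g. extends_to F g \<infinity> then \<infinity>
      else (THE \<rho>. 1 < \<rho> \<and> \<rho> < \<infinity> \<and>
             (\<exists>g. extends_to F g \<rho> \<and>
               (\<exists>z\<in>frontier (bernstein_ellipse \<rho>).
                  \<not> analytic_at_rel g (bernstein_ellipse \<rho>) z))))"

text \<open>The analytic continuation to the ellipse of parameter \<open>rho_A F\<close>; it is determined only on
  that ellipse, and meaningful only if \<open>rho_A F > 1\<close>.\<close>

definition continuation :: "(real \<Rightarrow> real) \<Rightarrow> complex \<Rightarrow> complex" where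
  "continuation F = (SOME g. extends_to F g (rho_A F))"

definition inf_Re :: "(real \<Rightarrow> real) \<Rightarrow> ereal \<Rightarrow> ereal" where
  "inf_Re F \<rho> = (INF u\<in>bernstein_ellipse \<rho>. ereal (Re (continuation F u)))"

definition rho_0 :: "(real \<Rightarrow> real) \<Rightarrow> ereal" where
  "rho_0 F = (THE \<rho>. 1 < \<rho> \<and> \<rho> < rho_A F \<and> inf_Re F \<rho> = 0)"

definition rho_hat :: "(real \<Rightarrow> real) \<Rightarrow> ereal" where
  "rho_hat F = (if inf_Re F (rho_A F) \<ge> 0 then rho_A F else rho_0 F)"

definition F_class :: "real \<Rightarrow> (real \<Rightarrow> real) set" where
  "F_class r = {\<phi>. continuous_on {-1..1} \<phi> \<and> strict_mono_on {-1..1} \<phi> \<and>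
     \<phi> (-1) = r \<and> \<phi> 1 = 1}"

definition admissible :: "real \<Rightarrow> (real \<Rightarrow> real) set" where
  "admissible r = {\<phi> \<in> F_class r. rho_A \<phi> > 1}"

text \<open>The restriction of \<open>\<Phi>\<^sub>r\<close> to \<open>[-1,1]\<close> (where it is real-valued) as a real function.\<close>

definition Phi_real :: "real \<Rightarrow> real \<Rightarrow> real" where
  "Phi_real r x = Re (Phi r (of_real x))"

end

theory Submission
  imports Defs
begin

text \<open>
  Jacobi's imaginary transformation expresses \<open>dn (u + \<i> v)\<close> rationally through the real
  functions \<open>sn\<close>, \<open>cn\<close>, \<open>dn\<close> of the complementary moduli at \<open>u\<close> and \<open>v\<close>. Checking the
  Cauchy-Riemann equations for this formula yields the meromorphic continuation of \<open>dn\<close> without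
  any theory of elliptic functions, and shows that \<open>\<Phi>\<^sub>r\<close> maps the ellipse of parameter \<open>1/q\<close>
  into the right half plane with boundary values on the imaginary axis.

  Let \<open>\<phi>\<close> be a competitor with nonnegative real part on that ellipse. In the quotient of the Cayley
  transforms of \<open>\<phi>\<close> and \<open>\<Phi>\<^sub>r\<close> the denominator has a single zero, which is simple and lies at
  \<open>1\<close>, where the numerator vanishes as well; its modulus tends to 1 at the boundary. By the
  maximum principle the quotient is bounded by 1, and since it equals 1 at \<open>-1\<close>, where
  both functions have the value \<open>r\<close>, it is constant.
\<close>

section \<open>Real elliptic functions\<close>

text \<open>The constant comes from a change of scale: with w = K(k) z / pi the lines |Im w| = K(r)
  that carry the poles of dn become |Im z| = pi K(r) / K(k), and the cosine maps the strip between
  them onto the ellipse whose parameter is the exponential of that number, 1/q.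

  Two obstacles shape the proof. The notions in the statement are definite descriptions, so
  existence and uniqueness come first: dn is pinned down by an identity theorem, and both radii are
  recast as attained suprema. Moreover Phi has a pole on the boundary, and a competitor need not
  have boundary values; hence the Cayley transform of Phi is estimated on smaller confocal ellipses,
  and the limit is taken only in the resulting bound.

  The upper bound and the case of equality both come from rigidity: a competitor whose radius of
  positivity is at least 1/q agrees with Phi on the ellipse, hence on [-1,1], hence has the same
  radius 1/q.\<close>

locale modulus =
  fixes k :: real
  assumes k_square: "k\<^sup>2 < 1"
begin

definition delta :: "real \<Rightarrow> real" where
  "delta \<theta> = sqrt (1 - k\<^sup>2 * (sin \<theta>)\<^sup>2)"

lemma delta_arg_pos: "0 < 1 - k\<^sup>2 * (sin \<theta>)\<^sup>2"
proof -
  have "(sin \<theta>)\<^sup>2 \<le> 1" by (simp add: abs_square_le_1)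
  then have "k\<^sup>2 * (sin \<theta>)\<^sup>2 \<le> k\<^sup>2 * 1" by (intro mult_left_mono) auto
  with k_square show ?thesis by linarith
qed

lemma delta_pos [simp]: "0 < delta \<theta>"
  using delta_arg_pos by (simp add: delta_def)

lemma delta_nonzero [simp]: "delta \<theta> \<noteq> 0"
  using delta_pos[of \<theta>] by linarith

lemma delta_le_1: "delta \<theta> \<le> 1"
  by (simp add: delta_def)

lemma continuous_delta: "continuous_on A delta"
  unfolding delta_def by (intro continuous_intros)

lemma ellipF_DERIV: "(ellipF k has_real_derivative 1 / delta \<phi>) (at \<phi>)"
proof -
  \<comment> \<open>The fundamental theorem gives a derivative within [a,b]; the interval has to
    contain the base point 0 and have \<phi> in its interior.\<close>
  define a b where "a = min 0 \<phi> - 1" and "b = max 0 \<phi> + 1"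
  have "((\<lambda>u. LBINT y=ereal 0..ereal u. 1 / delta y) has_vector_derivative 1 / delta \<phi>)
      (at \<phi> within {a..b})"
    by (rule interval_integral_FTC2)
       (auto simp: a_def b_def intro!: continuous_intros continuous_delta)
  moreover have "at \<phi> within {a..b} = at \<phi>"
    by (rule at_within_interior) (auto simp: a_def b_def interior_atLeastAtMost_real)
  ultimately show ?thesis
    by (simp add: has_real_derivative_iff_has_vector_derivative ellipF_def[abs_def] delta_def[abs_def])
qed

lemma ellipF_0 [simp]: "ellipF k 0 = 0"
  by (simp add: ellipF_def zero_ereal_def[symmetric])

text \<open>The integrand is at least 1. This single estimate yields both injectivity and
  surjectivity of \<open>ellipF k\<close>.\<close>

lemma ellipF_growth:
  assumes "a \<le> b" shows "b - a \<le> ellipF k b - ellipF k a"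
proof -
  have "ellipF k a - a \<le> ellipF k b - b"
  proof (rule DERIV_nonneg_imp_nondecreasing[OF assms])
    fix x
    have "((\<lambda>x. ellipF k x - x) has_real_derivative (1 / delta x - 1)) (at x)"
      by (intro derivative_intros ellipF_DERIV)
    moreover have "0 \<le> 1 / delta x - 1"
      using delta_pos[of x] delta_le_1[of x] by (simp add: field_simps)
    ultimately show "\<exists>y. ((\<lambda>x. ellipF k x - x) has_real_derivative y) (at x) \<and> 0 \<le> y"
      by blast
  qed
  then show ?thesis by linarith
qed

lemma ellipF_strict_mono: "strict_mono (ellipF k)"
proof (rule strict_monoI)
  fix x y :: real assume "x < y"
  with ellipF_growth[of x y] show "ellipF k x < ellipF k y" by linarith
qed

lemma isCont_ellipF: "isCont (ellipF k) x"
  using ellipF_DERIV DERIV_isCont by blast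

lemma ellipF_surj: "\<exists>\<phi>. ellipF k \<phi> = u"
proof -
  have "\<exists>x. - \<bar>u\<bar> \<le> x \<and> x \<le> \<bar>u\<bar> \<and> ellipF k x = u"
    using ellipF_growth[of 0 "\<bar>u\<bar>"] ellipF_growth[of "- \<bar>u\<bar>" 0]
    by (intro IVT) (auto simp: isCont_ellipF)
  then show ?thesis by blast
qed

lemma ellipF_eq_iff [simp]: "ellipF k x = ellipF k y \<longleftrightarrow> x = y"
  using strict_mono_eq[OF ellipF_strict_mono] .

lemma ellipF_am [simp]: "ellipF k (jacobi_am k u) = u"
proof -
  obtain \<phi> where "ellipF k \<phi> = u" using ellipF_surj by blast
  then show ?thesis
    unfolding jacobi_am_def by (rule theI) (use \<open>ellipF k \<phi> = u\<close> in auto)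
qed

lemma am_ellipF [simp]: "jacobi_am k (ellipF k x) = x"
  using ellipF_am[of "ellipF k x"] by (simp only: ellipF_eq_iff)

lemma am_eqI: "ellipF k x = u \<Longrightarrow> jacobi_am k u = x"
  by auto

lemma am_strict_mono: "strict_mono (jacobi_am k)"
  by (rule strict_monoI) (metis ellipF_am ellipF_strict_mono strict_mono_less)

lemma isCont_am: "isCont (jacobi_am k) u"
proof -
  have "isCont (jacobi_am k) (ellipF k (jacobi_am k u))"
    by (rule isCont_inverse_function[of 1]) (auto simp: isCont_ellipF)
  then show ?thesis by simp
qed

lemma ellipF_minus: "ellipF k (- x) = - ellipF k x"
proof -
  have "((\<lambda>x. ellipF k (- x) + ellipF k x) has_real_derivative 0) (at x)" for x
  proof -
    have "((\<lambda>x. ellipF k (- x) + ellipF k x) has_real_derivative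
        (1 / delta (- x) * (- 1) + 1 / delta x)) (at x)"
      by (intro derivative_intros ellipF_DERIV DERIV_chain2[OF ellipF_DERIV]) 
    then show ?thesis by (simp add: delta_def)
  qed
  from DERIV_isconst_all[rule_format, of "\<lambda>x. ellipF k (- x) + ellipF k x" x 0, OF this] show ?thesis by simp
qed

lemma ellipF_pi_half [simp]: "ellipF k (pi / 2) = ellipK k"
  by (simp add: ellipF_def ellipK_def)

lemma ellipF_add_pi: "ellipF k (x + pi) = ellipF k x + 2 * ellipK k"
proof -
  have "((\<lambda>x. ellipF k (x + pi) - ellipF k x) has_real_derivative 0) (at x)" for x
  proof -
    have "((\<lambda>x. ellipF k (x + pi) - ellipF k x) has_real_derivative
        (1 / delta (x + pi) * 1 - 1 / delta x)) (at x)"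
      by (intro derivative_intros ellipF_DERIV DERIV_chain2[OF ellipF_DERIV])
         (auto intro!: derivative_eq_intros)
    then show ?thesis by (simp add: delta_def)
  qed
  \<comment> \<open>The base point -pi/2 is symmetric to its translate pi/2, so oddness turns the
    constant into twice K.\<close>
  from DERIV_isconst_all[rule_format, of "\<lambda>x. ellipF k (x + pi) - ellipF k x" x "- (pi / 2)", OF this]
  have "ellipF k (x + pi) - ellipF k x = ellipF k (pi / 2) - ellipF k (- (pi / 2))"
    by simp
  then show ?thesis unfolding ellipF_minus by simp
qed

lemma ellipK_pos [simp]: "0 < ellipK k"
  using ellipF_strict_mono[THEN strict_monoD, of 0 "pi / 2"] by simp

lemma am_0 [simp]: "jacobi_am k 0 = 0" by (rule am_eqI) simp
lemma am_K [simp]: "jacobi_am k (ellipK k) = pi / 2" by (rule am_eqI) simp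
lemma am_minus [simp]: "jacobi_am k (- u) = - jacobi_am k u"
  by (rule am_eqI) (simp add: ellipF_minus)
lemma am_add_2K: "jacobi_am k (u + 2 * ellipK k) = jacobi_am k u + pi"
  by (rule am_eqI) (simp add: ellipF_add_pi)

section \<open>The Jacobi functions sn, cn, dn on the real line\<close>

definition sn :: "real \<Rightarrow> real" where "sn u = sin (jacobi_am k u)"
definition cn :: "real \<Rightarrow> real" where "cn u = cos (jacobi_am k u)"
definition dn :: "real \<Rightarrow> real" where "dn u = delta (jacobi_am k u)"

lemma cn_sq: "(cn u)\<^sup>2 = 1 - (sn u)\<^sup>2"
  by (simp add: sn_def cn_def cos_squared_eq)

lemma dn_sq: "(dn u)\<^sup>2 = 1 - k\<^sup>2 * (sn u)\<^sup>2"
  using delta_arg_pos[of "jacobi_am k u"] by (simp add: sn_def dn_def delta_def)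

lemma dn_pos [simp]: "0 < dn u" by (simp add: dn_def)
lemma dn_le_1: "dn u \<le> 1" by (simp add: dn_def delta_le_1)

lemma sn_0 [simp]: "sn 0 = 0" and cn_0 [simp]: "cn 0 = 1" and dn_0 [simp]: "dn 0 = 1"
  by (simp_all add: sn_def cn_def dn_def delta_def)

lemma sn_minus [simp]: "sn (- u) = - sn u" and cn_minus [simp]: "cn (- u) = cn u"
  and dn_minus [simp]: "dn (- u) = dn u"
  by (simp_all add: sn_def cn_def dn_def delta_def)

lemma sn_add_2K: "sn (u + 2 * ellipK k) = - sn u"
  and cn_add_2K: "cn (u + 2 * ellipK k) = - cn u"
  and dn_add_2K: "dn (u + 2 * ellipK k) = dn u"
  by (simp_all add: sn_def cn_def dn_def delta_def am_add_2K)

lemma sn_K [simp]: "sn (ellipK k) = 1" and cn_K [simp]: "cn (ellipK k) = 0"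
  by (simp_all add: sn_def cn_def)

lemma dn_K: "dn (ellipK k) = sqrt (1 - k\<^sup>2)"
  by (simp add: dn_def delta_def)

lemma am_DERIV: "(jacobi_am k has_real_derivative dn u) (at u)"
proof -
  have "DERIV (jacobi_am k) u :> inverse (1 / delta (jacobi_am k u))"
    by (rule DERIV_inverse_function[where f = "ellipF k" and a = "u - 1" and b = "u + 1"])
       (auto simp: isCont_am ellipF_DERIV)
  then show ?thesis by (simp add: dn_def)
qed

lemma sn_DERIV: "(sn has_real_derivative cn u * dn u) (at u)"
  unfolding sn_def[abs_def] cn_def by (rule DERIV_chain2[OF DERIV_sin am_DERIV])

lemma cn_DERIV: "(cn has_real_derivative - sn u * dn u) (at u)"
  unfolding sn_def cn_def[abs_def] by (rule DERIV_chain2[OF DERIV_cos am_DERIV])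

lemma dn_DERIV: "(dn has_real_derivative - k\<^sup>2 * sn u * cn u) (at u)"
proof -
  have "((\<lambda>u. 1 - k\<^sup>2 * (sn u)\<^sup>2) has_real_derivative - (k\<^sup>2 * (2 * sn u * (cn u * dn u)))) (at u)"
    by (rule derivative_eq_intros sn_DERIV refl)+ simp
  moreover have "0 < 1 - k\<^sup>2 * (sn u)\<^sup>2"
    using delta_arg_pos by (simp add: sn_def)
  ultimately have "((\<lambda>u. sqrt (1 - k\<^sup>2 * (sn u)\<^sup>2)) has_real_derivative
      inverse (sqrt (1 - k\<^sup>2 * (sn u)\<^sup>2)) / 2 * - (k\<^sup>2 * (2 * sn u * (cn u * dn u)))) (at u)"
    by (rule DERIV_chain2[OF DERIV_real_sqrt, rotated])
  moreover have "sqrt (1 - k\<^sup>2 * (sn v)\<^sup>2) = dn v" for v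
    by (simp add: sn_def dn_def delta_def)
  ultimately show ?thesis
    using dn_pos[of u] by (simp add: field_simps del: dn_pos)
qed

lemma cn_pos:
  assumes "\<bar>u\<bar> < ellipK k" shows "0 < cn u"
proof -
  have "- ellipK k < u" "u < ellipK k" using assms by linarith+
  then have "jacobi_am k (- ellipK k) < jacobi_am k u" "jacobi_am k u < jacobi_am k (ellipK k)"
    by (simp_all only: strict_mono_less[OF am_strict_mono])
  then have "- (pi / 2) < jacobi_am k u" "jacobi_am k u < pi / 2" by simp_all
  then show ?thesis unfolding cn_def by (rule cos_gt_zero_pi)
qed

lemma sn_eq_0D:
  assumes "sn u = 0" "\<bar>u\<bar> \<le> ellipK k" shows "u = 0"
proof -
  have "- ellipK k \<le> u" "u \<le> ellipK k" using assms(2) by linarith+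
  then have "jacobi_am k (- ellipK k) \<le> jacobi_am k u" "jacobi_am k u \<le> jacobi_am k (ellipK k)"
    by (simp_all only: strict_mono_less_eq[OF am_strict_mono])
  then have "- (pi / 2) \<le> jacobi_am k u" "jacobi_am k u \<le> pi / 2" by simp_all
  then have "jacobi_am k u = 0"
    using assms(1) pi_gt_zero unfolding sn_def
    by - (rule sin_eq_0_pi, linarith, linarith, assumption)
  then show "u = 0" by (metis ellipF_0 ellipF_am)
qed

text \<open>On [0,K] the amplitude runs from 0 to pi/2, so sn increases. Composed with the
  decreasing arccosine, this will make Phi increasing on [-1,1].\<close>

lemma dn_strict_decreasing:
  assumes "0 \<le> u" "u < v" "v \<le> ellipK k" "k \<noteq> 0" shows "dn v < dn u"
proof -
  have "jacobi_am k 0 \<le> jacobi_am k u" "jacobi_am k u < jacobi_am k v"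
      "jacobi_am k v \<le> jacobi_am k (ellipK k)"
    using assms am_strict_mono by (auto simp: strict_mono_less strict_mono_less_eq simp del: am_0 am_K)
  then have "0 \<le> sn u" "sn u < sn v"
    unfolding sn_def by (auto intro!: sin_ge_zero sin_monotone_2pi)
  then have "(sn u)\<^sup>2 < (sn v)\<^sup>2" by (intro power_strict_mono) auto
  then have "k\<^sup>2 * (sn u)\<^sup>2 < k\<^sup>2 * (sn v)\<^sup>2" using \<open>k \<noteq> 0\<close> by simp
  then have "(dn v)\<^sup>2 < (dn u)\<^sup>2" by (simp add: dn_sq)
  then show ?thesis by (rule power_less_imp_less_base) (simp add: less_imp_le)
qed

end

section \<open>The meromorphic continuation of the delta amplitude\<close>

text \<open>The Cauchy-Riemann equations are hidden in the shared coefficients \<open>a\<close> and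
  \<open>b\<close> of the two real derivatives.\<close>

lemma has_field_derivative_Complex:
  fixes p q :: "complex \<Rightarrow> real"
  assumes "(p has_derivative (\<lambda>h. a * Re h - b * Im h)) (at w)"
    and "(q has_derivative (\<lambda>h. b * Re h + a * Im h)) (at w)"
  shows "((\<lambda>w. Complex (p w) (q w)) has_field_derivative Complex a b) (at w)"
proof -
  have "((\<lambda>w. of_real (p w) + \<i> * of_real (q w)) has_derivative
      (\<lambda>h. of_real (a * Re h - b * Im h) + \<i> * of_real (b * Re h + a * Im h))) (at w)"
    by (intro derivative_intros assms)
  moreover have "(\<lambda>h. of_real (a * Re h - b * Im h) + \<i> * of_real (b * Re h + a * Im h))
      = (*) (Complex a b)"
    by (auto simp: complex_eq_iff)
  moreover have "(\<lambda>w. of_real (p w) + \<i> * of_real (q w)) = (\<lambda>w. Complex (p w) (q w))"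
    by (auto simp: complex_eq_iff)
  ultimately show ?thesis by (simp add: has_field_derivative_def)
qed

text \<open>Identity theorem along the real axis; it supplies the uniqueness behind the description
  of \<open>jacobi_dn\<close>.\<close>

lemma nicely_meromorphic_eqI:
  assumes f: "f nicely_meromorphic_on UNIV" and g: "g nicely_meromorphic_on UNIV"
    and eq: "\<And>x::real. f (of_real x) = g (of_real x)"
  shows "f = g"
proof -
  define h where "h = (\<lambda>z. f z - g z)"
  have mf: "f meromorphic_on UNIV" and mg: "g meromorphic_on UNIV"
    using f g by (auto simp: nicely_meromorphic_on_def)
  have mh: "h meromorphic_on UNIV"
    unfolding h_def by (intro meromorphic_intros mf mg)
  \<comment> \<open>At a common pole f - g can have a removable singularity with a wrong value, so
    the identity theorem is applied to \<open>remove_sings h\<close>.\<close>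
  have ev_eq: "eventually (\<lambda>w. remove_sings h w = h w) (at z)" for z
  proof -
    have "isolated_singularity_at h z"
      using mh by (meson UNIV_I meromorphic_at_iff meromorphic_on_subset subset_UNIV)
    then show ?thesis by (rule eventually_remove_sings_eq_at)
  qed
  have "frequently (\<lambda>z. h z = 0) (at 0)"
  proof -
    have "(0::complex) islimpt range complex_of_real"
      unfolding islimpt_approachable
    proof (intro allI impI)
      fix e :: real assume "0 < e"
      then show "\<exists>x'\<in>range complex_of_real. x' \<noteq> 0 \<and> dist x' 0 < e"
        by (intro bexI[of _ "of_real (e / 2)"]) (auto simp del: of_real_divide)
    qed
    then show ?thesis
      unfolding islimpt_conv_frequently_at by (rule frequently_elim1) (auto simp: h_def eq)
  qed
  then have "frequently (\<lambda>z. remove_sings h z = 0) (at 0)"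
    by (rule frequently_rev_mp) (use ev_eq[of 0] in eventually_elim, auto)
  then have 0: "remove_sings h z = 0" for z
    by (rule frequently_eq_meromorphic_imp_constant[where A = UNIV])
       (auto intro!: remove_sings_nicely_meromorphic mh)
  have ev: "eventually (\<lambda>w. f w = g w) (at z)" for z
    using ev_eq[of z] by eventually_elim (simp add: 0, simp add: h_def)
  show ?thesis
  proof
    fix z
    \<comment> \<open>A punctured neighbourhood determines the value of a nicely meromorphic
      function: 0 at a pole, the limit elsewhere.\<close>
    have "is_pole f z \<longleftrightarrow> is_pole g z" "(f \<longlongrightarrow> f z) (at z) \<longleftrightarrow> (g \<longlongrightarrow> f z) (at z)"
      using ev[of z] by (auto intro!: is_pole_cong tendsto_cong)
    moreover have "(is_pole f z \<and> f z = 0) \<or> f \<midarrow>z\<rightarrow> f z" "(is_pole g z \<and> g z = 0) \<or> g \<midarrow>z\<rightarrow> g z"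
      using f g by (auto simp: nicely_meromorphic_on_def)
    moreover have "\<not> (is_pole f z \<and> f \<midarrow>z\<rightarrow> f z)" "\<not> (is_pole g z \<and> g \<midarrow>z\<rightarrow> g z)"
      by (auto simp: is_pole_def dest!: not_tendsto_and_filterlim_at_infinity[rotated])
    ultimately show "f z = g z" by (metis LIM_unique)
  qed
qed

lemma DERIV_nonzero_imp_isolated:
  fixes f :: "real \<Rightarrow> real"
  assumes "(f has_real_derivative l) (at x)" "l \<noteq> 0"
  shows "eventually (\<lambda>y. f y \<noteq> f x) (at x)"
proof -
  have "((\<lambda>y. (f y - f x) / (y - x)) \<longlongrightarrow> l) (at x)"
    using assms(1) by (simp add: has_field_derivative_iff)
  then have "eventually (\<lambda>y. (f y - f x) / (y - x) \<noteq> 0) (at x)"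
    using assms(2) by (rule tendsto_imp_eventually_ne)
  then show ?thesis by eventually_elim auto
qed

text \<open>Modulus \<open>k\<close> governs the real direction and \<open>l\<close> the imaginary
  one. In the final theorem \<open>l\<close> is r.\<close>

locale complementary_moduli =
  fixes k l :: real
  assumes k_pos: "0 < k" and l_pos: "0 < l" and moduli_sum: "k\<^sup>2 + l\<^sup>2 = 1"
begin

sublocale K: modulus k
  by unfold_locales (use l_pos moduli_sum zero_less_power[of l 2] in linarith)
sublocale L: modulus l
  by unfold_locales (use k_pos moduli_sum zero_less_power[of k 2] in linarith)

text \<open>Jacobi's imaginary transformation turns the addition theorem for \<open>dn (u + \<i> v)\<close> into a
  formula in the real functions of modulus \<open>k\<close> at \<open>u\<close> and of the complementary modulus \<open>l\<close>
  at \<open>v\<close>; here it serves as the definition. At the poles division by zero yields the value 0.\<close>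

definition cdn_den :: "complex \<Rightarrow> real" where
  "cdn_den w = (L.cn (Im w))\<^sup>2 + k\<^sup>2 * (K.sn (Re w))\<^sup>2 * (L.sn (Im w))\<^sup>2"

definition cdn :: "complex \<Rightarrow> complex" where
  "cdn w = Complex (K.dn (Re w) * L.cn (Im w) * L.dn (Im w) / cdn_den w)
     (- (k\<^sup>2 * K.sn (Re w) * K.cn (Re w) * L.sn (Im w)) / cdn_den w)"

lemma cdn_den_nonneg: "0 \<le> cdn_den w"
  by (simp add: cdn_den_def)

text \<open>Both squares must vanish, and \<open>L.sn\<close> and \<open>L.cn\<close> have no common
  zero. The zeros form the pole lattice 2 m K(k) + (2 n + 1) i K(l).\<close>

lemma cdn_den_eq_0_iff: "cdn_den w = 0 \<longleftrightarrow> K.sn (Re w) = 0 \<and> L.cn (Im w) = 0"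
proof -
  have "cdn_den w = 0 \<longleftrightarrow> L.cn (Im w) = 0 \<and> K.sn (Re w) * L.sn (Im w) = 0"
    using k_pos by (auto simp: cdn_den_def add_nonneg_eq_0_iff)
  moreover have "L.sn (Im w) \<noteq> 0" if "L.cn (Im w) = 0"
    using that L.cn_sq[of "Im w"] by auto
  ultimately show ?thesis by auto
qed

lemma cdn_has_derivative:
  assumes "cdn_den w \<noteq> 0"
  shows "\<exists>f'. (cdn has_field_derivative f') (at w)"
proof -
  define s c d S C E where
    "s = K.sn (Re w)" "c = K.cn (Re w)" "d = K.dn (Re w)"
    "S = L.sn (Im w)" "C = L.cn (Im w)" "E = L.dn (Im w)"
  note defs = this
  \<comment> \<open>These relations eliminate all squares except those of s, S and k, which turns
    the equations below into polynomial identities.\<close>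
  have rel: "c\<^sup>2 = 1 - s\<^sup>2" "d\<^sup>2 = 1 - k\<^sup>2 * s\<^sup>2" "C\<^sup>2 = 1 - S\<^sup>2" "E\<^sup>2 = 1 - l\<^sup>2 * S\<^sup>2" "l\<^sup>2 = 1 - k\<^sup>2"
    using moduli_sum by (auto simp: defs K.cn_sq K.dn_sq L.cn_sq L.dn_sq)
  define D where "D = C\<^sup>2 + k\<^sup>2 * s\<^sup>2 * S\<^sup>2"
  have D: "cdn_den w = D" by (simp add: cdn_den_def D_def defs)
  define N where "N = d * C * E"
  define M where "M = k\<^sup>2 * s * c * S"
  \<comment> \<open>The real part is N/D and the imaginary part -M/D; the suffixes x and y mark
    partial derivatives in Re w and Im w. \<open>Dy\<close> already uses the relation for d
    squared.\<close>
  define Nx where "Nx = - (k\<^sup>2 * s * c * C * E)"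
  define Ny where "Ny = - (d * S * (E\<^sup>2 + l\<^sup>2 * C\<^sup>2))"
  define Mx where "Mx = k\<^sup>2 * S * d * (c\<^sup>2 - s\<^sup>2)"
  define My where "My = k\<^sup>2 * s * c * C * E"
  define Dx where "Dx = 2 * k\<^sup>2 * s * c * d * S\<^sup>2"
  define Dy where "Dy = - (2 * S * C * E * d\<^sup>2)"
  have dRe: "(Re has_derivative Re) (at w)" and dIm: "(Im has_derivative Im) (at w)"
    using bounded_linear_Re bounded_linear_Im by (auto intro: bounded_linear_imp_has_derivative)
  note ders =
    DERIV_compose_FDERIV[OF K.sn_DERIV dRe, folded defs] DERIV_compose_FDERIV[OF K.cn_DERIV dRe, folded defs]
    DERIV_compose_FDERIV[OF K.dn_DERIV dRe, folded defs] DERIV_compose_FDERIV[OF L.sn_DERIV dIm, folded defs]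
    DERIV_compose_FDERIV[OF L.cn_DERIV dIm, folded defs] DERIV_compose_FDERIV[OF L.dn_DERIV dIm, folded defs]
  have dD: "(cdn_den has_derivative (\<lambda>h. Dx * Re h + Dy * Im h)) (at w)"
    unfolding cdn_den_def[abs_def]
    apply (rule has_derivative_eq_rhs)
     apply (rule derivative_intros ders)+
    apply (simp add: fun_eq_iff defs[symmetric] Dx_def Dy_def rel(2))
    apply (simp add: algebra_simps power2_eq_square)
    done
  have dN: "((\<lambda>w. K.dn (Re w) * L.cn (Im w) * L.dn (Im w)) has_derivative
      (\<lambda>h. Nx * Re h + Ny * Im h)) (at w)"
    apply (rule has_derivative_eq_rhs)
     apply (rule derivative_intros ders)+
    apply (simp add: fun_eq_iff defs[symmetric] Nx_def Ny_def)
    apply (simp add: algebra_simps power2_eq_square)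
    done
  have dM: "((\<lambda>w. - (k\<^sup>2 * K.sn (Re w) * K.cn (Re w) * L.sn (Im w))) has_derivative
      (\<lambda>h. - (Mx * Re h + My * Im h))) (at w)"
    apply (rule has_derivative_eq_rhs)
     apply (rule derivative_intros ders)+
    apply (simp add: fun_eq_iff defs[symmetric] Mx_def My_def)
    apply (simp add: algebra_simps power2_eq_square)
    done
  \<comment> \<open>Numerators of the equation u_y = - v_x; \<open>cr2\<close> is u_x = v_y.\<close>
  have cr1: "Ny * D - N * Dy = Mx * D - M * Dx"
  proof -
    have "Ny * D - N * Dy = d * S * (2 * C\<^sup>2 * E\<^sup>2 * d\<^sup>2 - (E\<^sup>2 + l\<^sup>2 * C\<^sup>2) * D)"
      by (simp add: Ny_def N_def Dy_def power2_eq_square algebra_simps)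
    moreover have "Mx * D - M * Dx = d * S * (k\<^sup>2 * (c\<^sup>2 - s\<^sup>2) * D - 2 * (k\<^sup>2)\<^sup>2 * s\<^sup>2 * c\<^sup>2 * S\<^sup>2)"
      by (simp add: Mx_def M_def Dx_def power2_eq_square algebra_simps)
    moreover have "2 * C\<^sup>2 * E\<^sup>2 * d\<^sup>2 - (E\<^sup>2 + l\<^sup>2 * C\<^sup>2) * D
        = k\<^sup>2 * (c\<^sup>2 - s\<^sup>2) * D - 2 * (k\<^sup>2)\<^sup>2 * s\<^sup>2 * c\<^sup>2 * S\<^sup>2"
      unfolding D_def rel by algebra
    ultimately show ?thesis by simp
  qed
  have cr2: "Nx * D - N * Dx = - (My * D - M * Dy)"
    by (simp add: Nx_def N_def Dx_def My_def M_def Dy_def power2_eq_square algebra_simps)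
  define a where "a = (Nx * D - N * Dx) / D\<^sup>2"
  define P where "P = Mx * D - M * Dx"
  define b where "b = - P / D\<^sup>2"
  have "D \<noteq> 0" using assms D by simp
  have dp: "((\<lambda>w. K.dn (Re w) * L.cn (Im w) * L.dn (Im w) / cdn_den w) has_derivative
      (\<lambda>h. a * Re h - b * Im h)) (at w)"
  proof (rule has_derivative_eq_rhs[OF has_derivative_divide'[OF dN dD assms]])
    show "(\<lambda>h. ((Nx * Re h + Ny * Im h) * cdn_den w
        - K.dn (Re w) * L.cn (Im w) * L.dn (Im w) * (Dx * Re h + Dy * Im h))
        / (cdn_den w * cdn_den w)) = (\<lambda>h. a * Re h - b * Im h)"
    proof
      fix h
      have "((Nx * Re h + Ny * Im h) * D - N * (Dx * Re h + Dy * Im h)) / (D * D)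
          = (Nx * D - N * Dx) / D\<^sup>2 * Re h + P / D\<^sup>2 * Im h"
        using \<open>D \<noteq> 0\<close> unfolding P_def cr1[symmetric] by (simp add: field_simps power2_eq_square)
      then show "((Nx * Re h + Ny * Im h) * cdn_den w
        - K.dn (Re w) * L.cn (Im w) * L.dn (Im w) * (Dx * Re h + Dy * Im h))
        / (cdn_den w * cdn_den w) = a * Re h - b * Im h"
        unfolding D a_def b_def defs[symmetric] N_def by simp
    qed
  qed
  have dq: "((\<lambda>w. - (k\<^sup>2 * K.sn (Re w) * K.cn (Re w) * L.sn (Im w)) / cdn_den w) has_derivative
      (\<lambda>h. b * Re h + a * Im h)) (at w)"
  proof (rule has_derivative_eq_rhs[OF has_derivative_divide'[OF dM dD assms]])
    show "(\<lambda>h. (- (Mx * Re h + My * Im h) * cdn_den w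
        - - (k\<^sup>2 * K.sn (Re w) * K.cn (Re w) * L.sn (Im w)) * (Dx * Re h + Dy * Im h))
        / (cdn_den w * cdn_den w)) = (\<lambda>h. b * Re h + a * Im h)"
    proof
      fix h
      have "(- (Mx * Re h + My * Im h) * D - - M * (Dx * Re h + Dy * Im h)) / (D * D)
          = - P / D\<^sup>2 * Re h + - (My * D - M * Dy) / D\<^sup>2 * Im h"
        using \<open>D \<noteq> 0\<close> unfolding P_def by (simp add: field_simps power2_eq_square)
      then show "(- (Mx * Re h + My * Im h) * cdn_den w
        - - (k\<^sup>2 * K.sn (Re w) * K.cn (Re w) * L.sn (Im w)) * (Dx * Re h + Dy * Im h))
        / (cdn_den w * cdn_den w) = b * Re h + a * Im h"
        unfolding D a_def b_def cr2 M_def defs[symmetric] by simp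
    qed
  qed
  show ?thesis
    using has_field_derivative_Complex[OF dp dq] by (auto simp: cdn_def[abs_def])
qed

lemma continuous_cdn_den: "continuous_on UNIV cdn_den"
  unfolding cdn_den_def[abs_def]
  by (intro continuous_intros continuous_on_compose2[OF DERIV_continuous_on[OF K.sn_DERIV]]
      continuous_on_compose2[OF DERIV_continuous_on[OF L.sn_DERIV]]
      continuous_on_compose2[OF DERIV_continuous_on[OF L.cn_DERIV]]) auto

lemma cdn_analytic: "cdn analytic_on {w. cdn_den w \<noteq> 0}"
proof -
  have "open {w. cdn_den w \<noteq> 0}"
    by (intro open_Collect_neq continuous_cdn_den continuous_intros)
  moreover from this have "cdn holomorphic_on {w. cdn_den w \<noteq> 0}"
    using cdn_has_derivative by (auto simp: holomorphic_on_open)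
  ultimately show ?thesis by (simp add: analytic_on_open)
qed

text \<open>At a zero of the denominator both \<open>K.sn\<close> and \<open>L.cn\<close> vanish
  with nonzero derivative, so each coordinate separately is isolated.\<close>

lemma cdn_den_isolated: "eventually (\<lambda>w. cdn_den w \<noteq> 0) (at w\<^sub>0)"
proof (cases "cdn_den w\<^sub>0 = 0")
  case False
  have "(cdn_den \<longlongrightarrow> cdn_den w\<^sub>0) (at w\<^sub>0)"
    using continuous_cdn_den by (simp add: continuous_on_eq_continuous_at isContD)
  then show ?thesis using False by (rule tendsto_imp_eventually_ne)
next
  case True
  then have z: "K.sn (Re w\<^sub>0) = 0" "L.cn (Im w\<^sub>0) = 0" by (auto simp: cdn_den_eq_0_iff)
  have "K.cn (Re w\<^sub>0) \<noteq> 0" "L.sn (Im w\<^sub>0) \<noteq> 0"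
    using z K.cn_sq[of "Re w\<^sub>0"] L.cn_sq[of "Im w\<^sub>0"] by auto
  then have ne: "K.cn (Re w\<^sub>0) * K.dn (Re w\<^sub>0) \<noteq> 0" "- L.sn (Im w\<^sub>0) * L.dn (Im w\<^sub>0) \<noteq> 0"
    using K.dn_pos[of "Re w\<^sub>0"] L.dn_pos[of "Im w\<^sub>0"]
    by (auto simp del: K.dn_pos L.dn_pos)
  obtain d e where d: "d > 0" "\<And>x. x \<noteq> Re w\<^sub>0 \<Longrightarrow> dist x (Re w\<^sub>0) < d \<Longrightarrow> K.sn x \<noteq> 0"
    and e: "e > 0" "\<And>y. y \<noteq> Im w\<^sub>0 \<Longrightarrow> dist y (Im w\<^sub>0) < e \<Longrightarrow> L.cn y \<noteq> 0"
    using DERIV_nonzero_imp_isolated[OF K.sn_DERIV ne(1)] DERIV_nonzero_imp_isolated[OF L.cn_DERIV ne(2)] z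
    by (auto simp: eventually_at)
  show ?thesis
    unfolding eventually_at
  proof (intro exI[of _ "min d e"] conjI ballI impI)
    fix w assume w: "w \<noteq> w\<^sub>0 \<and> dist w w\<^sub>0 < min d e"
    have "dist (Re w) (Re w\<^sub>0) < d" "dist (Im w) (Im w\<^sub>0) < e"
      using w abs_Re_le_cmod[of "w - w\<^sub>0"] abs_Im_le_cmod[of "w - w\<^sub>0"]
      by (auto simp: dist_norm)
    then show "cdn_den w \<noteq> 0"
      using w d(2) e(2) by (auto simp: cdn_den_eq_0_iff complex_eq_iff)
  qed (use d e in auto)
qed

text \<open>One power of the denominator cancels. The numerator that remains is positive at the
  zeros of the denominator, which makes those zeros poles.\<close>

lemma norm_cdn_sq:
  assumes "cdn_den w \<noteq> 0"
  shows "(cmod (cdn w))\<^sup>2 = ((L.dn (Im w))\<^sup>2 - k\<^sup>2 * (K.sn (Re w))\<^sup>2) / cdn_den w"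
proof -
  define s c d S C E where
    "s = K.sn (Re w)" "c = K.cn (Re w)" "d = K.dn (Re w)"
    "S = L.sn (Im w)" "C = L.cn (Im w)" "E = L.dn (Im w)"
  note defs = this
  have rel: "c\<^sup>2 = 1 - s\<^sup>2" "d\<^sup>2 = 1 - k\<^sup>2 * s\<^sup>2" "C\<^sup>2 = 1 - S\<^sup>2" "E\<^sup>2 = 1 - l\<^sup>2 * S\<^sup>2" "l\<^sup>2 = 1 - k\<^sup>2"
    using moduli_sum by (auto simp: defs K.cn_sq K.dn_sq L.cn_sq L.dn_sq)
  define D where "D = C\<^sup>2 + k\<^sup>2 * s\<^sup>2 * S\<^sup>2"
  have D: "cdn_den w = D" by (simp add: cdn_den_def D_def defs)
  have "d\<^sup>2 * C\<^sup>2 * E\<^sup>2 + (k\<^sup>2)\<^sup>2 * s\<^sup>2 * c\<^sup>2 * S\<^sup>2 = D * (E\<^sup>2 - k\<^sup>2 * s\<^sup>2)"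
    unfolding D_def rel by algebra
  then have "(d * C * E)\<^sup>2 + (k\<^sup>2 * s * c * S)\<^sup>2 = D * (E\<^sup>2 - k\<^sup>2 * s\<^sup>2)"
    by (simp add: power_mult_distrib)
  moreover have "(cmod (cdn w))\<^sup>2 = ((d * C * E)\<^sup>2 + (k\<^sup>2 * s * c * S)\<^sup>2) / D\<^sup>2"
    by (simp add: cdn_def cmod_power2 D defs power_divide add_divide_distrib)
  ultimately show ?thesis
    using assms D by (simp add: defs power2_eq_square)
qed

lemma L_dn_sq_ge: "k\<^sup>2 \<le> (L.dn v)\<^sup>2"
proof -
  have "(L.sn v)\<^sup>2 \<le> 1" using L.cn_sq[of v] zero_le_power2[of "L.cn v"] by linarith
  then have "l\<^sup>2 * (L.sn v)\<^sup>2 \<le> l\<^sup>2 * 1" by (intro mult_left_mono) auto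
  then show ?thesis using moduli_sum by (simp add: L.dn_sq)
qed

lemma cdn_pole:
  assumes "cdn_den w\<^sub>0 = 0" shows "is_pole cdn w\<^sub>0"
proof -
  let ?n = "\<lambda>w. (L.dn (Im w))\<^sup>2 - k\<^sup>2 * (K.sn (Re w))\<^sup>2"
  have "continuous_on UNIV ?n"
    by (intro continuous_intros continuous_on_compose2[OF DERIV_continuous_on[OF K.sn_DERIV]]
      continuous_on_compose2[OF DERIV_continuous_on[OF L.dn_DERIV]]) auto
  then have "(?n \<longlongrightarrow> ?n w\<^sub>0) (at w\<^sub>0)"
    unfolding continuous_on_def by (rule bspec) simp
  moreover have "0 < ?n w\<^sub>0"
    using assms k_pos L_dn_sq_ge[of "Im w\<^sub>0"] by (auto simp: cdn_den_eq_0_iff)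
  moreover have "(cdn_den \<longlongrightarrow> 0) (at w\<^sub>0)"
    using continuous_cdn_den assms unfolding continuous_on_def by (metis UNIV_I)
  moreover have "eventually (\<lambda>w. 0 < cdn_den w) (at w\<^sub>0)"
    using cdn_den_isolated[of w\<^sub>0] by eventually_elim (metis cdn_den_nonneg order_le_less)
  ultimately have "LIM w at w\<^sub>0. ?n w / cdn_den w :> at_top"
    by (rule LIM_at_top_divide)
  then have "LIM w at w\<^sub>0. sqrt (?n w / cdn_den w) :> at_top"
    by (rule filterlim_compose[OF sqrt_at_top])
  moreover have "eventually (\<lambda>w. sqrt (?n w / cdn_den w) = norm (cdn w)) (at w\<^sub>0)"
    using cdn_den_isolated[of w\<^sub>0] by eventually_elim (simp add: norm_cdn_sq[symmetric])
  ultimately have "LIM w at w\<^sub>0. norm (cdn w) :> at_top"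
    using filterlim_cong[OF refl refl] by fast
  then show ?thesis
    unfolding is_pole_def by (rule filterlim_norm_at_top_imp_at_infinity)
qed

lemma cdn_nicely_meromorphic: "cdn nicely_meromorphic_on UNIV"
proof (rule nicely_meromorphic_onI_open[where pts = "{w. cdn_den w = 0}"])
  show "cdn analytic_on UNIV - {w. cdn_den w = 0}"
    using cdn_analytic by (rule analytic_on_subset) auto
  show "is_pole cdn w \<and> cdn w = 0" if "w \<in> {w. cdn_den w = 0}" for w
    using that cdn_pole by (auto simp: cdn_def complex_eq_iff)
  show "isolated_singularity_at cdn w" for w
  proof -
    obtain e where "e > 0" "\<And>z. z \<noteq> w \<Longrightarrow> dist z w < e \<Longrightarrow> cdn_den z \<noteq> 0"
      using cdn_den_isolated[of w] by (auto simp: eventually_at)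
    then have "cdn analytic_on ball w e - {w}"
      by (intro analytic_on_subset[OF cdn_analytic]) (auto simp: dist_commute)
    with \<open>e > 0\<close> show ?thesis unfolding isolated_singularity_at_def by blast
  qed
qed auto

lemma cdn_of_real: "cdn (of_real u) = of_real (K.dn u)"
  by (simp add: cdn_def cdn_den_def complex_eq_iff)

text \<open>From here on the description of \<open>jacobi_dn\<close> is replaced by an explicit
  formula.\<close>

lemma jacobi_dn_eq_cdn: "jacobi_dn k = cdn"
proof -
  have *: "of_real (sqrt (1 - k\<^sup>2 * (sin (jacobi_am k u))\<^sup>2)) = cdn (of_real u)" for u
    by (simp add: cdn_of_real K.dn_def K.delta_def)
  show ?thesis
    unfolding jacobi_dn_def *
    by (rule the_equality) (auto intro: cdn_nicely_meromorphic nicely_meromorphic_eqI)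
qed

section \<open>Symmetries, and values in the strip between the poles\<close>

lemma cdn_minus: "cdn (- w) = cdn w"
  by (simp add: cdn_def cdn_den_def)

lemma cdn_add_2K: "cdn (w + of_real (2 * ellipK k)) = cdn w"
  by (simp add: cdn_def cdn_den_def K.sn_add_2K K.cn_add_2K K.dn_add_2K)

lemma cdn_den_pos_strip:
  assumes "\<bar>Im w\<bar> < ellipK l" shows "0 < cdn_den w"
  using L.cn_pos[OF assms] cdn_den_nonneg[of w] by (auto simp: order_le_less cdn_den_eq_0_iff)

lemma Re_cdn_pos:
  assumes "\<bar>Im w\<bar> < ellipK l" shows "0 < Re (cdn w)"
  using L.cn_pos[OF assms] cdn_den_pos_strip[OF assms] by (simp add: cdn_def)

text \<open>Locates the zeros of the Cayley transform. A real value forces w onto one of three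
  families of lines, and each is examined separately.\<close>

lemma cdn_eq_1_iff:
  assumes "\<bar>Im w\<bar> < ellipK l"
  shows "cdn w = 1 \<longleftrightarrow> K.sn (Re w) = 0 \<and> Im w = 0"
proof
  assume w: "cdn w = 1"
  note D = cdn_den_pos_strip[OF assms] and C = L.cn_pos[OF assms]
  have C1: "L.cn (Im w) \<le> 1" by (simp add: L.cn_def)
  have CE: "L.cn (Im w) \<le> L.dn (Im w)"
  proof (rule power2_le_imp_le)
    have "l\<^sup>2 * (L.sn (Im w))\<^sup>2 \<le> 1 * (L.sn (Im w))\<^sup>2"
      using L.k_square by (intro mult_right_mono) auto
    then show "(L.cn (Im w))\<^sup>2 \<le> (L.dn (Im w))\<^sup>2" by (simp add: L.cn_sq L.dn_sq)
  qed (simp add: less_imp_le)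
  have N: "K.dn (Re w) * L.cn (Im w) * L.dn (Im w) = cdn_den w"
    and M: "K.sn (Re w) * K.cn (Re w) * L.sn (Im w) = 0"
    using w D k_pos by (auto simp: cdn_def complex_eq_iff field_simps)
  from M consider "K.sn (Re w) = 0" | "L.sn (Im w) = 0" | "K.cn (Re w) = 0" by auto
  then show "K.sn (Re w) = 0 \<and> Im w = 0"
  proof cases
    \<comment> \<open>On these vertical lines the value is the quotient dn/cn of modulus
      \<open>l\<close> at Im w, which is 1 only where sn vanishes.\<close>
    case 1
    then have "(K.dn (Re w))\<^sup>2 = 1" by (simp add: K.dn_sq)
    then have "K.dn (Re w) = 1" using K.dn_pos[of "Re w"] by (simp add: power2_eq_1_iff)
    with N 1 C have "L.dn (Im w) = L.cn (Im w)"
      by (simp add: cdn_den_def power2_eq_square)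
    then have "(L.dn (Im w))\<^sup>2 = (L.cn (Im w))\<^sup>2" by simp
    then have "(1 - l\<^sup>2) * (L.sn (Im w))\<^sup>2 = 0" by (simp add: L.cn_sq L.dn_sq algebra_simps)
    then have "L.sn (Im w) = 0" using L.k_square by simp
    with 1 assms show ?thesis by (simp add: L.sn_eq_0D)
  next
    case 2
    then have v: "Im w = 0" using assms by (simp add: L.sn_eq_0D)
    with N have "K.dn (Re w) = 1" by (simp add: cdn_den_def)
    with K.dn_sq[of "Re w"] k_pos v show ?thesis by simp
  next
    \<comment> \<open>On these vertical lines the value is \<open>K.dn\<close> times cn/dn of
      modulus \<open>l\<close>; the first factor is below 1 and the second at most 1, so 1 is not
      attained.\<close>
    case 3
    then have s: "(K.sn (Re w))\<^sup>2 = 1" using K.cn_sq[of "Re w"] by simp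
    have "cdn_den w = (L.dn (Im w))\<^sup>2"
      using moduli_sum s by (simp add: cdn_den_def L.cn_sq L.dn_sq algebra_simps)
        (metis add_diff_cancel_left' diff_add_cancel mult.commute right_diff_distrib' mult_1)
    with N have "K.dn (Re w) * L.cn (Im w) = L.dn (Im w)"
      using L.dn_pos[of "Im w"] by (simp add: power2_eq_square)
    moreover have "K.dn (Re w) < 1"
    proof (rule power_less_imp_less_base)
      show "(K.dn (Re w))\<^sup>2 < 1\<^sup>2" using k_pos by (simp add: K.dn_sq s)
    qed simp
    then have "K.dn (Re w) * L.cn (Im w) < 1 * L.cn (Im w)" using C by simp
    ultimately show ?thesis using CE by simp
  qed
next
  assume "K.sn (Re w) = 0 \<and> Im w = 0"
  then show "cdn w = 1"
    using K.dn_sq[of "Re w"] K.dn_pos[of "Re w"]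
    by (auto simp: cdn_def cdn_den_def complex_eq_iff power2_eq_1_iff)
qed

text \<open>The Cayley transform of \<open>cdn\<close> tends to modulus 1, uniformly in \<open>Re w\<close>, as \<open>w\<close>
  approaches the lines \<open>\<bar>Im w\<bar> = K(l)\<close>.\<close>

lemma norm_Cayley_cdn:
  assumes "\<bar>Im w\<bar> < ellipK l"
  shows "1 - 4 * L.cn (Im w) / k\<^sup>2 \<le> (cmod ((cdn w - 1) / (cdn w + 1)))\<^sup>2"
proof -
  note D = cdn_den_pos_strip[OF assms] and C = L.cn_pos[OF assms]
  let ?x = "Re (cdn w)" and ?n = "(cmod (cdn w))\<^sup>2"
  have x: "0 < ?x" using Re_cdn_pos[OF assms] .
  have n: "?n = ?x\<^sup>2 + (Im (cdn w))\<^sup>2" by (simp add: cmod_power2)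
  \<comment> \<open>These two expansions give 1 - |Cayley|^2 = 4 x / (n + 2 x + 1), so only this
    fraction has to be bounded.\<close>
  have p: "(cmod (cdn w + 1))\<^sup>2 = ?n + 2 * ?x + 1" and m: "(cmod (cdn w - 1))\<^sup>2 = ?n - 2 * ?x + 1"
    unfolding cmod_power2 by (simp_all add: power2_eq_square algebra_simps)
  \<comment> \<open>Uniformity in Re w arises here: after multiplication by the denominator, 1 + n
    is at least k^2 and x is at most \<open>L.cn (Im w)\<close>.\<close>
  have "cdn_den w * (1 + ?n) = cdn_den w + ((L.dn (Im w))\<^sup>2 - k\<^sup>2 * (K.sn (Re w))\<^sup>2)"
    using D norm_cdn_sq[of w] by (simp add: distrib_left)
  also have "\<dots> = (L.dn (Im w))\<^sup>2 + (L.cn (Im w))\<^sup>2 * (K.dn (Re w))\<^sup>2"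
    by (simp add: cdn_den_def L.cn_sq K.dn_sq algebra_simps)
  finally have "k\<^sup>2 \<le> cdn_den w * (1 + ?n)"
    using L_dn_sq_ge[of "Im w"] by (simp add: add_increasing2)
  moreover have "cdn_den w * ?x \<le> L.cn (Im w)"
  proof -
    have "K.dn (Re w) * L.dn (Im w) \<le> 1 * 1"
      by (intro mult_mono K.dn_le_1 L.dn_le_1) (simp_all add: less_imp_le)
    then have "K.dn (Re w) * L.dn (Im w) * L.cn (Im w) \<le> 1 * L.cn (Im w)"
      using C by (intro mult_right_mono) auto
    then show ?thesis using D by (simp add: cdn_def mult_ac)
  qed
  ultimately have "(cdn_den w * ?x) * k\<^sup>2 \<le> L.cn (Im w) * (cdn_den w * (1 + ?n))"
    using C by (intro mult_mono) auto
  then have "cdn_den w * (?x * k\<^sup>2) \<le> cdn_den w * (L.cn (Im w) * (1 + ?n))"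
    by (simp add: mult_ac)
  then have "?x * k\<^sup>2 \<le> L.cn (Im w) * (1 + ?n)" using D by simp
  also have "\<dots> \<le> L.cn (Im w) * (?n + 2 * ?x + 1)" using C x by simp
  finally have "?x / (?n + 2 * ?x + 1) \<le> L.cn (Im w) / k\<^sup>2"
    using x k_pos by (simp add: divide_simps add_pos_nonneg algebra_simps)
  moreover have "(cmod ((cdn w - 1) / (cdn w + 1)))\<^sup>2 = 1 - 4 * (?x / (?n + 2 * ?x + 1))"
  proof -
    have "?n + 2 * ?x + 1 \<noteq> 0" using x by (smt (verit) zero_le_power2)
    then show ?thesis
      unfolding norm_divide power_divide p m by (simp add: field_simps)
  qed
  ultimately show ?thesis by simp
qed

end

section \<open>Bernstein ellipses as images of strips\<close>

lemma Re_cos_complex: "Re (cos z) = cos (Re z) * cosh (Im z)"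
  by (simp add: Re_cos cosh_def)

lemma Im_cos_complex: "Im (cos z) = - sin (Re z) * sinh (Im z)"
  by (simp add: Im_cos sinh_field_def field_simps)

text \<open>The cosine maps the strip \<open>\<bar>Im z\<bar> < log \<rho>\<close> onto the ellipse of parameter \<open>\<rho>\<close>, since
  \<open>cos (x + \<i> y) = cos x cosh y - \<i> sin x sinh y\<close>.\<close>

lemma cos_in_bernstein_ellipse_iff:
  assumes "1 < \<rho>"
  shows "cos z \<in> bernstein_ellipse \<rho> \<longleftrightarrow> ereal (exp \<bar>Im z\<bar>) < \<rho>"
proof (cases \<rho>)
  case PInf
  then show ?thesis by (simp add: bernstein_ellipse_def)
next
  case MInf
  then show ?thesis using assms by simp
next
  case (real R)
  with assms have R: "1 < R" by (simp add: one_ereal_def)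
  \<comment> \<open>With R = exp L the semi-axes are cosh L and sinh L.\<close>
  define L where "L = ln R"
  have L: "0 < L" using R by (simp add: L_def)
  have ch: "(R + inverse R) / 2 = cosh L" and sh: "(R - inverse R) / 2 = sinh L"
    using R by (simp_all add: L_def cosh_ln_real sinh_ln_real)
  define x y where "x = Re z" and "y = \<bar>Im z\<bar>"
  have y: "0 \<le> y" by (simp add: y_def)
  have pos: "0 < (cosh L)\<^sup>2" "0 < (sinh L)\<^sup>2" using L by auto
  define p q where "p = (cosh y)\<^sup>2 / (cosh L)\<^sup>2" and "q = (sinh y)\<^sup>2 / (sinh L)\<^sup>2"
  have cy: "(cosh (Im z))\<^sup>2 = (cosh y)\<^sup>2" "(sinh (Im z))\<^sup>2 = (sinh y)\<^sup>2"
    by (auto simp: y_def abs_if)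
  have expr: "(Re (cos z))\<^sup>2 / (cosh L)\<^sup>2 + (Im (cos z))\<^sup>2 / (sinh L)\<^sup>2
      = (cos x)\<^sup>2 * p + (sin x)\<^sup>2 * q"
    by (simp add: Re_cos_complex Im_cos_complex power_mult_distrib cy p_def q_def x_def)
  \<comment> \<open>A convex combination of p and q: both are below 1 when y < L, and both are at
    least 1 otherwise.\<close>
  have "(cos x)\<^sup>2 * p + (sin x)\<^sup>2 * q < 1 \<longleftrightarrow> y < L"
  proof
    assume "y < L"
    then have "cosh y < cosh L" "sinh y < sinh L"
      using y by (simp_all add: cosh_real_strict_mono)
    then have "(cosh y)\<^sup>2 < (cosh L)\<^sup>2" "(sinh y)\<^sup>2 < (sinh L)\<^sup>2"
      using y by (auto intro!: power_strict_mono)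
    then have pq: "p < 1" "q < 1" using pos by (auto simp: p_def q_def)
    show "(cos x)\<^sup>2 * p + (sin x)\<^sup>2 * q < 1"
      using convex_bound_lt[OF pq, of "(cos x)\<^sup>2" "(sin x)\<^sup>2"] by simp
  next
    assume less: "(cos x)\<^sup>2 * p + (sin x)\<^sup>2 * q < 1"
    show "y < L"
    proof (rule ccontr)
      assume "\<not> y < L"
      then have "cosh L \<le> cosh y" "sinh L \<le> sinh y"
        using y L by (simp_all add: cosh_real_nonneg_le_iff)
      then have "(cosh L)\<^sup>2 \<le> (cosh y)\<^sup>2" "(sinh L)\<^sup>2 \<le> (sinh y)\<^sup>2"
        using L by (auto intro!: power_mono)
      then have "1 \<le> p" "1 \<le> q" using pos by (auto simp: p_def q_def)
      then have "(cos x)\<^sup>2 * 1 + (sin x)\<^sup>2 * 1 \<le> (cos x)\<^sup>2 * p + (sin x)\<^sup>2 * q"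
        by (intro add_mono mult_left_mono) auto
      with less show False by simp
    qed
  qed
  also have "y < L \<longleftrightarrow> exp y < R" using R by (simp add: L_def flip: exp_less_cancel_iff[of y "ln R"])
  finally show ?thesis
    using real expr by (simp add: bernstein_ellipse_def Let_def ch sh y_def)
qed

text \<open>The parameter of the confocal ellipse through u, with value 1 on the segment [-1,1].
  Ellipses become sublevel sets of this function, which makes nesting and unions immediate.\<close>

definition ell_param :: "complex \<Rightarrow> real" where
  "ell_param u = exp \<bar>Im (Arccos u)\<bar>"

lemma bernstein_ellipse_eq: "1 < \<rho> \<Longrightarrow> bernstein_ellipse \<rho> = {u. ereal (ell_param u) < \<rho>}"
  using cos_in_bernstein_ellipse_iff[of \<rho> "Arccos _"] by (auto simp: ell_param_def)

lemma bernstein_ellipse_real: "1 < R \<Longrightarrow> bernstein_ellipse (ereal R) = {u. ell_param u < R}"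
  by (simp add: bernstein_ellipse_eq one_ereal_def)

lemma ell_param_ge_1: "1 \<le> ell_param u"
  by (simp add: ell_param_def)

text \<open>Shows that the branch of the arccosine in \<open>ell_param\<close> is irrelevant. Two
  numbers that are at least 1 and lie below the same R > 1 coincide.\<close>

lemma ell_param_cos [simp]: "ell_param (cos z) = exp \<bar>Im z\<bar>"
proof -
  have *: "ell_param (cos z) < R \<longleftrightarrow> exp \<bar>Im z\<bar> < R" if "1 < R" for R
    using cos_in_bernstein_ellipse_iff[of "ereal R" z] bernstein_ellipse_real[of R] that
    by (auto simp: one_ereal_def)
  have "1 \<le> ell_param (cos z)" "1 \<le> exp \<bar>Im z\<bar>" by (simp_all add: ell_param_def)
  then show ?thesis
    using *[of "ell_param (cos z)"] *[of "exp \<bar>Im z\<bar>"] by (metis less_irrefl linorder_less_linear order_less_le)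
qed

lemma ell_param_real [simp]:
  assumes "x \<in> {-1..1}" shows "ell_param (of_real x) = 1"
proof -
  have "ell_param (cos (of_real (arccos x))) = 1" by (subst ell_param_cos) simp
  moreover have "cos (of_real (arccos x)) = (of_real x :: complex)"
    using assms by (simp only: cos_of_real) simp
  ultimately show ?thesis by simp
qed

lemma ell_param_eq_1D: "ell_param u = 1 \<Longrightarrow> u \<in> of_real ` {-1..1}"
proof -
  assume "ell_param u = 1"
  then have "Im (Arccos u) = 0" by (simp add: ell_param_def)
  then have "u = cos (of_real (Re (Arccos u)))"
    by (metis cos_Arccos complex_is_Real_iff of_real_Re)
  then have "u = of_real (cos (Re (Arccos u)))" by (simp add: cos_of_real)
  then show ?thesis by (metis atLeastAtMost_iff cos_ge_minus_one cos_le_one image_eqI)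
qed

lemma real_in_bernstein_ellipse: "1 < \<rho> \<Longrightarrow> x \<in> {-1..1} \<Longrightarrow> of_real x \<in> bernstein_ellipse \<rho>"
  by (simp add: bernstein_ellipse_eq one_ereal_def del: atLeastAtMost_iff)

lemma bernstein_ellipse_mono:
  "1 < \<rho> \<Longrightarrow> \<rho> \<le> \<rho>' \<Longrightarrow> bernstein_ellipse \<rho> \<subseteq> bernstein_ellipse \<rho>'"
  by (auto simp: bernstein_ellipse_eq)

text \<open>A finite ellipse is the preimage of the unit disc under a scaling of the axes.\<close>

lemma open_convex_bernstein_ellipse:
  assumes "1 < \<rho>" shows "open (bernstein_ellipse \<rho>)" "convex (bernstein_ellipse \<rho>)"
proof -
  have "open (bernstein_ellipse \<rho>) \<and> convex (bernstein_ellipse \<rho>)"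
  proof (cases "\<rho> = \<infinity>")
    case True
    then show ?thesis by (simp add: bernstein_ellipse_def)
  next
    case False
    define a b where "a = (real_of_ereal \<rho> + inverse (real_of_ereal \<rho>)) / 2"
      and "b = (real_of_ereal \<rho> - inverse (real_of_ereal \<rho>)) / 2"
    define f where "f = (\<lambda>z. Complex (Re z / a) (Im z / b))"
    have lin: "linear f"
      by (rule linearI) (auto simp: f_def complex_eq_iff add_divide_distrib)
    have "bernstein_ellipse \<rho> = f -` ball 0 1"
      using False
      by (auto simp: bernstein_ellipse_def Let_def f_def a_def b_def cmod_def power_divide
          real_sqrt_lt_1_iff)
    moreover have "open (f -` ball 0 1)"
      by (intro open_vimage linear_continuous_on linear_conv_bounded_linear[THEN iffD1] lin) auto
    moreover have "convex (f -` ball 0 1)"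
      by (intro convex_linear_vimage lin convex_ball)
    ultimately show ?thesis by simp
  qed
  then show "open (bernstein_ellipse \<rho>)" "convex (bernstein_ellipse \<rho>)" by auto
qed

lemma connected_bernstein_ellipse: "1 < \<rho> \<Longrightarrow> connected (bernstein_ellipse \<rho>)"
  by (intro convex_connected open_convex_bernstein_ellipse)

section \<open>Closed ellipses: compactness, closure, frontier and enlargement\<close>

definition strip_rect :: "real \<Rightarrow> complex set" where
  "strip_rect L = {z. \<bar>Re z\<bar> \<le> pi \<and> \<bar>Im z\<bar> \<le> L}"

lemma compact_strip_rect: "compact (strip_rect L)"
proof -
  have "strip_rect L = cbox (Complex (- pi) (- L)) (Complex pi L)"
    by (auto simp: strip_rect_def in_cbox_complex_iff)
  then show ?thesis by simp
qed

text \<open>The principal arccosine has real part in [-pi,pi], so a compact rectangle covers the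
  closed ellipse and transfers its compactness.\<close>

lemma cos_strip_rect: "1 \<le> R \<Longrightarrow> cos ` strip_rect (ln R) = {u. ell_param u \<le> R}"
proof -
  assume "1 \<le> R"
  then have R: "exp t \<le> R \<longleftrightarrow> t \<le> ln R" for t by (simp add: ln_ge_iff)
  have "u \<in> cos ` strip_rect (ln R)" if "ell_param u \<le> R" for u
    using that Re_Arccos_bound[of u]
    by (intro image_eqI[of _ _ "Arccos u"]) (auto simp: strip_rect_def ell_param_def R)
  then show ?thesis by (auto simp: strip_rect_def R)
qed

lemma compact_ell_param_le: "1 \<le> R \<Longrightarrow> compact {u. ell_param u \<le> R}"
  by (subst cos_strip_rect[symmetric])
     (auto intro!: compact_continuous_image compact_strip_rect continuous_intros)

lemma closure_bernstein_ellipse: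
  assumes "1 < R" shows "closure (bernstein_ellipse (ereal R)) = {u. ell_param u \<le> R}"
proof
  show "closure (bernstein_ellipse (ereal R)) \<subseteq> {u. ell_param u \<le> R}"
    using assms by (intro closure_minimal compact_imp_closed compact_ell_param_le)
      (auto simp: bernstein_ellipse_real)
  show "{u. ell_param u \<le> R} \<subseteq> closure (bernstein_ellipse (ereal R))"
  proof
    fix u assume "u \<in> {u. ell_param u \<le> R}"
    then have u: "exp \<bar>Im (Arccos u)\<bar> \<le> R" by (simp add: ell_param_def)
    define z where "z = Arccos u"
    \<comment> \<open>Shrinking the imaginary part of a preimage by the factor \<open>t n\<close> <
      1 moves it strictly inside the strip.\<close>
    define t where "t n = 1 - inverse (real (Suc n))" for n
    define v where "v n = cos (Complex (Re z) (t n * Im z))" for n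
    have t: "0 \<le> t n" "t n < 1" for n by (auto simp: t_def field_simps)
    have "v n \<in> bernstein_ellipse (ereal R)" for n
    proof -
      have "exp \<bar>t n * Im z\<bar> < R"
      proof (cases "Im z = 0")
        case False
        then have "\<bar>t n * Im z\<bar> < \<bar>Im z\<bar>" using t[of n] by (simp add: abs_mult)
        then have "exp \<bar>t n * Im z\<bar> < exp \<bar>Im z\<bar>" by simp
        with u show ?thesis unfolding z_def by linarith
      qed (use assms in simp)
      then show ?thesis using assms by (simp add: v_def cos_in_bernstein_ellipse_iff one_ereal_def)
    qed
    moreover have "v \<longlonglongrightarrow> cos (Complex (Re z) ((1 - 0) * Im z))"
      unfolding v_def t_def
      by (intro tendsto_cos tendsto_Complex tendsto_intros LIMSEQ_inverse_real_of_nat)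
    then have "v \<longlonglongrightarrow> u" by (simp add: z_def)
    ultimately show "u \<in> closure (bernstein_ellipse (ereal R))"
      unfolding closure_sequential by blast
  qed
qed

lemma frontier_bernstein_ellipse:
  assumes "1 < R" shows "frontier (bernstein_ellipse (ereal R)) = {u. ell_param u = R}"
proof -
  have "open (bernstein_ellipse (ereal R))"
    using assms by (intro open_convex_bernstein_ellipse) (simp add: one_ereal_def)
  then have "frontier (bernstein_ellipse (ereal R)) = {u. ell_param u \<le> R} - {u. ell_param u < R}"
    unfolding frontier_def using assms
    by (simp add: interior_open closure_bernstein_ellipse flip: bernstein_ellipse_real)
  then show ?thesis by auto
qed

text \<open>Compactness gives the rectangle a uniform margin e inside the preimage of U, and
  widening the strip by e multiplies the parameter by exp e. The case R = 1 covers neighbourhoods of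
  the segment.\<close>

lemma bernstein_ellipse_enlarge:
  assumes "1 \<le> R" "open U" "{u. ell_param u \<le> R} \<subseteq> U"
  obtains R' where "R < R'" "bernstein_ellipse (ereal R') \<subseteq> U"
proof -
  define L where "L = ln R"
  have L: "0 \<le> L" "exp L = R" using assms(1) by (auto simp: L_def)
  have "open (cos -` U)"
    by (intro open_vimage assms continuous_intros)
  moreover have "strip_rect L \<subseteq> cos -` U"
    using assms(3) unfolding cos_strip_rect[OF assms(1), symmetric] L_def by blast
  ultimately obtain e where e: "e > 0" "(\<Union>z\<in>strip_rect L. ball z e) \<subseteq> cos -` U"
    using compact_subset_open_imp_ball_epsilon_subset[OF compact_strip_rect] by metis
  show ?thesis
  proof
    show gt: "R < exp (L + e)" using L(2) e(1) by (metis exp_less_cancel_iff less_add_same_cancel1)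
    show "bernstein_ellipse (ereal (exp (L + e))) \<subseteq> U"
    proof
      fix u assume "u \<in> bernstein_ellipse (ereal (exp (L + e)))"
      then have "ell_param u < exp (L + e)"
        by (simp only: bernstein_ellipse_real[OF order_le_less_trans[OF assms(1) gt]] mem_Collect_eq)
      then have y: "\<bar>Im (Arccos u)\<bar> < L + e" by (simp add: ell_param_def)
      define z where "z = Arccos u"
      \<comment> \<open>Clamping the imaginary part yields a point of the rectangle at distance less
        than e.\<close>
      define z' where "z' = Complex (Re z) (max (- L) (min L (Im z)))"
      have "z' \<in> strip_rect L"
        using L(1) Re_Arccos_bound[of u] by (auto simp: strip_rect_def z'_def z_def)
      moreover have "z - z' = \<i> * of_real (Im z - max (- L) (min L (Im z)))"
        by (simp add: complex_eq_iff z'_def)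
      then have "cmod (z - z') = \<bar>Im z - max (- L) (min L (Im z))\<bar>"
        by (metis norm_mult norm_ii mult_1 norm_of_real)
      then have "dist z' z < e"
        using y L(1) e(1) by (auto simp: dist_norm norm_minus_commute z_def[symmetric])
      ultimately have "z \<in> (\<Union>z\<in>strip_rect L. ball z e)" by (auto intro: bexI[of _ z'])
      then have "z \<in> cos -` U" using e(2) by blast
      then show "u \<in> U" by (simp add: z_def)
    qed
  qed
qed

section \<open>The radius of analyticity and the radius of positivity\<close>

text \<open>Convexity makes the local extensions compatible: two balls centred in the closure of
  \<open>S\<close> that meet at all also meet along the segment of their centres, hence meet \<open>S\<close>.\<close>

lemma glue_local_extensions:
  assumes S: "convex S" "a \<in> S" "b \<in> S" "a \<noteq> b"
    and loc: "\<And>z. z \<in> closure S \<Longrightarrow> analytic_at_rel g S z"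
  obtains U G where "open U" "closure S \<subseteq> U" "G holomorphic_on U" "\<And>w. w \<in> S \<Longrightarrow> G w = g w"
proof -
  have "\<forall>z\<in>closure S. \<exists>e h. 0 < e \<and> h holomorphic_on ball z e \<and> (\<forall>w\<in>ball z e \<inter> S. h w = g w)"
    using loc by (auto simp: analytic_at_rel_def)
  then obtain e h where e: "\<And>z. z \<in> closure S \<Longrightarrow> 0 < e z"
    and h: "\<And>z. z \<in> closure S \<Longrightarrow> h z holomorphic_on ball z (e z)"
    and hg: "\<And>z w. z \<in> closure S \<Longrightarrow> w \<in> ball z (e z) \<Longrightarrow> w \<in> S \<Longrightarrow> h z w = g w"
    unfolding bchoice_iff by (metis IntI)
  have compat: "h z w = h z' w"
    if z: "z \<in> closure S" "z' \<in> closure S" and w: "w \<in> ball z (e z)" "w \<in> ball z' (e z')" for z z' w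
  proof -
    let ?B = "ball z (e z) \<inter> ball z' (e z')"
    have d: "dist z z' < e z + e z'" using w dist_triangle_less_add[of z w "e z" z' "e z'"]
      by (simp add: dist_commute)
    have ez: "0 < e z" "0 < e z'" using e z by auto
    \<comment> \<open>Divides the segment between the centres in the ratio of the radii, so the
      dividing point lies in both balls.\<close>
    define \<tau> where "\<tau> = e z / (e z + e z')"
    define t where "t = z + \<tau> *\<^sub>R (z' - z)"
    have \<tau>: "0 < \<tau>" "\<tau> < 1" using ez by (auto simp: \<tau>_def)
    have tz: "t - z = \<tau> *\<^sub>R (z' - z)" and tz': "t - z' = (1 - \<tau>) *\<^sub>R (z - z')"
      by (simp_all add: t_def algebra_simps)
    have "dist z t = \<tau> * dist z z'"
      using \<tau> tz by (metis abs_of_pos dist_commute dist_norm norm_scaleR)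
    also have "\<dots> < \<tau> * (e z + e z')" using d \<tau> by simp
    finally have 1: "dist z t < e z" using ez by (simp add: \<tau>_def)
    have "dist z' t = (1 - \<tau>) * dist z z'"
      using \<tau> tz' by (metis abs_of_pos diff_gt_0_iff_gt dist_commute dist_norm norm_scaleR)
    also have "\<dots> < (1 - \<tau>) * (e z + e z')" using d \<tau> by simp
    also have "(1 - \<tau>) * (e z + e z') = e z'" using ez by (simp add: \<tau>_def field_simps)
    finally have 2: "dist z' t < e z'" .
    have "t \<in> closure S"
    proof -
      have "t = (1 - \<tau>) *\<^sub>R z + \<tau> *\<^sub>R z'" by (simp add: t_def algebra_simps)
      then show ?thesis using convexD_alt[OF convex_closure[OF S(1)] z, of \<tau>] \<tau> by simp
    qed
    with 1 2 have "?B \<inter> closure S \<noteq> {}" by auto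
    then have "?B \<inter> S \<noteq> {}" using open_Int_closure_eq_empty[of ?B S] by auto
    then obtain s where s: "s \<in> ?B" "s \<in> S" by blast
    \<comment> \<open>The two distinct points a and b enter here: a connected set with more than one
      point has no isolated points, so the identity theorem applies.\<close>
    have "s islimpt S"
      using S s(2) by (intro connected_imp_perfect convex_connected) auto
    moreover have "eventually (\<lambda>y. y \<in> ?B) (at s)"
      using s(1) by (intro eventually_at_in_open') auto
    ultimately have lim: "s islimpt S \<inter> ?B" by (rule islimpt_Int_eventually)
    have "h z w - h z' w = 0"
    proof (rule analytic_continuation[of "\<lambda>w. h z w - h z' w" ?B "S \<inter> ?B" s])
      show "(\<lambda>w. h z w - h z' w) holomorphic_on ?B"
        using h z by (intro holomorphic_intros) (auto intro: holomorphic_on_subset)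
      show "connected ?B" by (intro convex_connected convex_Int convex_ball)
      show "h z y - h z' y = 0" if "y \<in> S \<inter> ?B" for y
        using that hg z by auto
    qed (use s w lim in auto)
    then show ?thesis by simp
  qed
  \<comment> \<open>Any ball containing w will do, since \<open>compat\<close> makes the value
    independent of the choice.\<close>
  define c where "c w = (SOME z. z \<in> closure S \<and> w \<in> ball z (e z))" for w
  define U where "U = (\<Union>z\<in>closure S. ball z (e z))"
  have G: "h (c w) w = h z w" if "z \<in> closure S" "w \<in> ball z (e z)" for z w
  proof -
    have "c w \<in> closure S \<and> w \<in> ball (c w) (e (c w))"
      unfolding c_def by (rule someI[of _ z]) (use that in auto)
    then show ?thesis using compat that by blast
  qed
  show ?thesis
  proof
    show "open U" by (auto simp: U_def)
    show "closure S \<subseteq> U" using e by (force simp: U_def)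
    show "(\<lambda>w. h (c w) w) holomorphic_on U"
      unfolding U_def
      by (intro holomorphic_on_UN_open open_ball) (rule holomorphic_transform[OF h], auto simp: G)
    show "h (c w) w = g w" if "w \<in> S" for w
      using G[of w w] hg[of w w] that e closure_subset[of S] by auto
  qed
qed

lemma segment_islimpt: "0 islimpt complex_of_real ` {-1..1}"
proof (rule connected_imp_perfect)
  show "connected (complex_of_real ` {-1..1})"
    by (intro connected_continuous_image continuous_intros) auto
  show "complex_of_real ` {- 1..1} \<noteq> {x}" for x
  proof
    assume "complex_of_real ` {- 1..1} = {x}"
    then have "complex_of_real 0 = x" "complex_of_real 1 = x" by auto
    then show False by simp
  qed
qed (auto intro!: image_eqI[of _ _ 0])

lemma extends_to_mono:
  "1 < \<rho> \<Longrightarrow> \<rho> \<le> \<rho>' \<Longrightarrow> extends_to F g \<rho>' \<Longrightarrow> extends_to F g \<rho>"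
  by (auto simp: extends_to_def intro: holomorphic_on_subset bernstein_ellipse_mono[THEN subsetD])

lemma extends_to_unique:
  assumes "1 < \<rho>" "extends_to F g \<rho>" "extends_to F g' \<rho>" "u \<in> bernstein_ellipse \<rho>"
  shows "g u = g' u"
proof -
  have "g u - g' u = 0"
  proof (rule analytic_continuation[of "\<lambda>w. g w - g' w" "bernstein_ellipse \<rho>" "of_real ` {-1..1}" 0])
    show "(\<lambda>w. g w - g' w) holomorphic_on bernstein_ellipse \<rho>"
      using assms by (auto simp: extends_to_def intro!: holomorphic_intros)
    show "0 \<in> bernstein_ellipse \<rho>"
      using real_in_bernstein_ellipse[OF assms(1), of 0] by simp
    show "g z - g' z = 0" if "z \<in> of_real ` {-1..1}" for z
      using that assms by (auto simp: extends_to_def)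
  qed (use assms open_convex_bernstein_ellipse connected_bernstein_ellipse segment_islimpt
      real_in_bernstein_ellipse in \<open>auto simp del: atLeastAtMost_iff\<close>)
  then show ?thesis by simp
qed

lemma holomorphic_imp_analytic_at_rel:
  assumes "g holomorphic_on T" "open T" "z \<in> T" "\<And>w. w \<in> S \<Longrightarrow> w \<in> T \<Longrightarrow> g w = f w"
  shows "analytic_at_rel f S z"
proof -
  obtain e where "e > 0" "ball z e \<subseteq> T" using assms open_contains_ball by blast
  then show ?thesis
    unfolding analytic_at_rel_def
    using assms(1,4) by (intro exI[of _ e] conjI exI[of _ g]) (auto intro: holomorphic_on_subset)
qed

lemma extends_to_imp_analytic_at_pt:
  assumes "1 < \<rho>" "extends_to F g \<rho>" "x \<in> {-1..1}"
  shows "analytic_at_pt F x"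
  unfolding analytic_at_pt_def
proof (rule holomorphic_imp_analytic_at_rel)
  show "g holomorphic_on bernstein_ellipse \<rho>" using assms by (simp add: extends_to_def)
  show "g w = of_real (F (Re w))" if "w \<in> of_real ` {-1..1}" for w
    using that assms by (auto simp: extends_to_def)
qed (use assms open_convex_bernstein_ellipse real_in_bernstein_ellipse in auto)

text \<open>The local extensions are glued along the segment, and compactness leaves room for an
  ellipse. This makes \<open>rho_A F > 1\<close> yield an actual continuation.\<close>

lemma extends_to_small_ellipse:
  assumes "\<And>x. x \<in> {-1..1} \<Longrightarrow> analytic_at_pt F x"
  obtains \<rho> g where "1 < \<rho>" "extends_to F g \<rho>"
proof -
  let ?S = "complex_of_real ` {-1..1}"
  have cl: "closure ?S = ?S"
    by (intro closure_closed compact_imp_closed compact_continuous_image continuous_intros) auto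
  have cv: "convex ?S" by (intro convex_linear_image linear_of_real) auto
  obtain U G where U: "open U" "closure ?S \<subseteq> U" "G holomorphic_on U"
    and G: "\<And>w. w \<in> ?S \<Longrightarrow> G w = of_real (F (Re w))"
  proof (rule glue_local_extensions[OF cv, of 0 1 "\<lambda>w. of_real (F (Re w))"])
    show "(0::complex) \<in> ?S" by (rule image_eqI[of _ _ 0]) auto
    show "(1::complex) \<in> ?S" by (rule image_eqI[of _ _ 1]) auto
    show "analytic_at_rel (\<lambda>w. of_real (F (Re w))) ?S z" if "z \<in> closure ?S" for z
      using that assms unfolding cl by (auto simp: analytic_at_pt_def)
  qed auto
  have "{u. ell_param u \<le> 1} \<subseteq> U"
  proof
    fix u assume "u \<in> {u. ell_param u \<le> 1}"
    then have "ell_param u = 1" using ell_param_ge_1[of u] by simp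
    then show "u \<in> U" using ell_param_eq_1D[of u] U(2) unfolding cl by blast
  qed
  then obtain R where R: "1 < R" "bernstein_ellipse (ereal R) \<subseteq> U"
    using bernstein_ellipse_enlarge[of 1 U] U(1) by auto
  show ?thesis
  proof
    show "1 < ereal R" using R by (simp add: one_ereal_def)
    show "extends_to F G (ereal R)"
      using R(2) U(3) G by (auto simp: extends_to_def intro: holomorphic_on_subset)
  qed
qed

section \<open>The radius of analyticity as an attained supremum\<close>

definition extension_params :: "(real \<Rightarrow> real) \<Rightarrow> ereal set" where
  "extension_params F = {\<rho>. 1 < \<rho> \<and> (\<exists>g. extends_to F g \<rho>)}"

lemma bernstein_ellipse_Sup:
  assumes "X \<noteq> {}" "\<And>\<rho>. \<rho> \<in> X \<Longrightarrow> 1 < \<rho>"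
  shows "1 < Sup X" "bernstein_ellipse (Sup X) = (\<Union>\<rho>\<in>X. bernstein_ellipse \<rho>)"
proof -
  show *: "1 < Sup X" using assms by (meson Sup_upper ex_in_conv less_le_trans)
  show "bernstein_ellipse (Sup X) = (\<Union>\<rho>\<in>X. bernstein_ellipse \<rho>)"
    using assms(2) * by (auto simp: bernstein_ellipse_eq less_Sup_iff)
qed

text \<open>Any two extensions agree on the smaller of their nested ellipses, so they patch together
  on the union, which is the ellipse of the supremum.\<close>

lemma Sup_extension_params:
  assumes "extension_params F \<noteq> {}"
  shows "Sup (extension_params F) \<in> extension_params F"
proof -
  let ?X = "extension_params F"
  have gt1: "1 < \<rho>" if "\<rho> \<in> ?X" for \<rho> using that by (simp add: extension_params_def)
  have "\<forall>\<rho>\<in>?X. \<exists>g. extends_to F g \<rho>" by (auto simp: extension_params_def)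
  then obtain g where g: "\<And>\<rho>. \<rho> \<in> ?X \<Longrightarrow> extends_to F (g \<rho>) \<rho>" by metis
  define c where "c u = (SOME \<rho>. \<rho> \<in> ?X \<and> u \<in> bernstein_ellipse \<rho>)" for u
  have G: "g (c u) u = g \<rho> u" if "\<rho> \<in> ?X" "u \<in> bernstein_ellipse \<rho>" for \<rho> u
  proof -
    have c: "c u \<in> ?X \<and> u \<in> bernstein_ellipse (c u)"
      unfolding c_def by (rule someI[of _ \<rho>]) (use that in auto)
    define m where "m = min (c u) \<rho>"
    have "1 < m" "m \<le> c u" "m \<le> \<rho>" using c that gt1 by (auto simp: m_def)
    moreover have "u \<in> bernstein_ellipse m" using c that by (auto simp: m_def min_def)
    ultimately show ?thesis using extends_to_unique[of m] extends_to_mono[of m] g c that by blast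
  qed
  have eq: "bernstein_ellipse (Sup ?X) = (\<Union>\<rho>\<in>?X. bernstein_ellipse \<rho>)"
    by (rule bernstein_ellipse_Sup(2)[OF assms gt1])
  have "extends_to F (\<lambda>u. g (c u) u) (Sup ?X)"
    unfolding extends_to_def
  proof (intro conjI ballI)
    show "(\<lambda>u. g (c u) u) holomorphic_on bernstein_ellipse (Sup ?X)"
      unfolding eq
    proof (rule holomorphic_on_UN_open)
      fix \<rho> assume \<rho>: "\<rho> \<in> ?X"
      then have "g \<rho> holomorphic_on bernstein_ellipse \<rho>" using g by (simp add: extends_to_def)
      then show "(\<lambda>u. g (c u) u) holomorphic_on bernstein_ellipse \<rho>"
        by (rule holomorphic_transform) (use G \<rho> in auto)
    qed (use gt1 open_convex_bernstein_ellipse in auto)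
    fix x :: real assume x: "x \<in> {-1..1}"
    obtain \<rho> where \<rho>: "\<rho> \<in> ?X" using assms by auto
    then have "g (c (of_real x)) (of_real x) = g \<rho> (of_real x)"
      using G real_in_bernstein_ellipse gt1 x by blast
    then show "g (c (of_real x)) (of_real x) = of_real (F x)"
      using g[OF \<rho>] x by (simp add: extends_to_def)
  qed
  then show ?thesis
    using bernstein_ellipse_Sup(1)[OF assms gt1] by (auto simp: extension_params_def)
qed

text \<open>Without a singular frontier point the extension glues over the closed ellipse and hence
  reaches a larger one. With the next lemma, a singular frontier point characterizes the maximal
  finite parameter.\<close>

lemma extension_not_maximal:
  assumes "1 < R" "extends_to F g (ereal R)"
    and "\<And>z. z \<in> frontier (bernstein_ellipse (ereal R)) \<Longrightarrow>
      analytic_at_rel g (bernstein_ellipse (ereal R)) z"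
  shows "\<exists>\<rho>\<in>extension_params F. ereal R < \<rho>"
proof -
  let ?E = "bernstein_ellipse (ereal R)"
  have R1: "1 < ereal R" using assms(1) by (simp add: one_ereal_def)
  have "analytic_at_rel g ?E z" if "z \<in> closure ?E" for z
  proof (cases "z \<in> ?E")
    case True
    then show ?thesis
      using assms(2) open_convex_bernstein_ellipse[OF R1]
      by (intro holomorphic_imp_analytic_at_rel[of g ?E]) (auto simp: extends_to_def)
  next
    case False
    with that have "z \<in> frontier ?E"
      using interior_subset[of ?E] by (auto simp: frontier_def)
    then show ?thesis by (rule assms(3))
  qed
  moreover have "of_real 0 \<in> ?E" "of_real 1 \<in> ?E"
    by (intro real_in_bernstein_ellipse R1; simp)+
  ultimately obtain U G where U: "open U" "closure ?E \<subseteq> U" "G holomorphic_on U"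
      and G: "\<And>w. w \<in> ?E \<Longrightarrow> G w = g w"
    using glue_local_extensions[OF open_convex_bernstein_ellipse(2)[OF R1], of "of_real 0" "of_real 1" g]
    by (metis of_real_0 of_real_1 zero_neq_one)
  obtain R' where R': "R < R'" "bernstein_ellipse (ereal R') \<subseteq> U"
    using bernstein_ellipse_enlarge[of R U] U assms(1) by (auto simp: closure_bernstein_ellipse)
  have "extends_to F G (ereal R')"
    using R'(2) U(3) G assms(2) real_in_bernstein_ellipse[OF R1]
    by (auto simp: extends_to_def intro: holomorphic_on_subset)
  then show ?thesis
    using R' assms(1) by (intro bexI[of _ "ereal R'"]) (auto simp: extension_params_def one_ereal_def)
qed

lemma extension_params_frontier_analytic:
  assumes "1 < R" "extends_to F g (ereal R)" "\<rho> \<in> extension_params F" "ereal R < \<rho>"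
    and "z \<in> frontier (bernstein_ellipse (ereal R))"
  shows "analytic_at_rel g (bernstein_ellipse (ereal R)) z"
proof -
  have R1: "1 < ereal R" using assms(1) by (simp add: one_ereal_def)
  obtain g' where g': "extends_to F g' \<rho>" "1 < \<rho>" using assms(3) by (auto simp: extension_params_def)
  show ?thesis
  proof (rule holomorphic_imp_analytic_at_rel)
    show "g' holomorphic_on bernstein_ellipse \<rho>" using g' by (simp add: extends_to_def)
    show "z \<in> bernstein_ellipse \<rho>"
    proof -
      have "ell_param z = R" using assms(1,5) by (simp add: frontier_bernstein_ellipse)
      then show ?thesis using assms(4) g'(2) by (simp add: bernstein_ellipse_eq)
    qed
    show "g' w = g w" if "w \<in> bernstein_ellipse (ereal R)" for w
      using that extends_to_unique[OF R1] extends_to_mono[OF R1] assms(2,4) g' by (metis less_imp_le)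
  qed (use g' open_convex_bernstein_ellipse in auto)
qed

text \<open>Resolves the description in \<open>rho_A\<close>: the supremum has a singular frontier
  point by maximality, and a smaller parameter cannot have one.\<close>

lemma rho_A_eq_Sup:
  assumes "extension_params F \<noteq> {}"
  shows "rho_A F = Sup (extension_params F)"
proof -
  let ?T = "Sup (extension_params F)"
  have T: "1 < ?T" "\<exists>g. extends_to F g ?T"
    using Sup_extension_params[OF assms] by (auto simp: extension_params_def)
  have an: "\<not> (\<exists>x\<in>{-1..1}. \<not> analytic_at_pt F x)"
    using T extends_to_imp_analytic_at_pt by blast
  show ?thesis
  proof (cases "\<exists>g. extends_to F g \<infinity>")
    case True
    then have "\<infinity> \<in> extension_params F" by (simp add: extension_params_def)
    then have "?T = \<infinity>" by (metis Sup_upper ereal_infty_less_eq(1))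
    then show ?thesis using True an by (simp add: rho_A_def)
  next
    case False
    then have "?T < \<infinity>" using T(2) by (metis ereal_infty_less(1))
    with T(1) obtain R where R: "?T = ereal R" "1 < R"
      by (cases ?T) (auto simp: one_ereal_def)
    obtain g where g: "extends_to F g (ereal R)" using T(2) R by auto
    have "(THE \<rho>. 1 < \<rho> \<and> \<rho> < \<infinity> \<and> (\<exists>g. extends_to F g \<rho> \<and>
        (\<exists>z\<in>frontier (bernstein_ellipse \<rho>). \<not> analytic_at_rel g (bernstein_ellipse \<rho>) z))) = ?T"
    proof (rule the_equality)
      have "\<exists>z\<in>frontier (bernstein_ellipse (ereal R)). \<not> analytic_at_rel g (bernstein_ellipse (ereal R)) z"
        using extension_not_maximal[OF R(2) g] by (metis R(1) Sup_upper leD)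
      then show "1 < ?T \<and> ?T < \<infinity> \<and> (\<exists>g. extends_to F g ?T \<and>
        (\<exists>z\<in>frontier (bernstein_ellipse ?T). \<not> analytic_at_rel g (bernstein_ellipse ?T) z))"
        using T(1) g R(1) by auto
    next
      fix \<rho> assume *: "1 < \<rho> \<and> \<rho> < \<infinity> \<and> (\<exists>g. extends_to F g \<rho> \<and>
        (\<exists>z\<in>frontier (bernstein_ellipse \<rho>). \<not> analytic_at_rel g (bernstein_ellipse \<rho>) z))"
      then obtain R' where R': "\<rho> = ereal R'" "1 < R'"
        by (cases \<rho>) (auto simp: one_ereal_def)
      have "\<rho> \<in> extension_params F" using * by (auto simp: extension_params_def)
      then have "\<rho> \<le> ?T" by (rule Sup_upper)
      moreover have "\<not> \<rho> < ?T"
        using extension_params_frontier_analytic[OF R'(2) _ Sup_extension_params[OF assms]] * R' by blast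
      ultimately show "\<rho> = ?T" by simp
    qed
    then show ?thesis using False an by (simp add: rho_A_def)
  qed
qed

lemma rho_A_gt_1_iff: "1 < rho_A F \<longleftrightarrow> extension_params F \<noteq> {}"
proof
  assume "1 < rho_A F"
  then have "\<And>x. x \<in> {-1..1} \<Longrightarrow> analytic_at_pt F x"
    by (auto simp: rho_A_def split: if_splits)
  then obtain \<rho> g where "1 < \<rho>" "extends_to F g \<rho>" by (rule extends_to_small_ellipse)
  then show "extension_params F \<noteq> {}" by (auto simp: extension_params_def)
next
  assume "extension_params F \<noteq> {}"
  then show "1 < rho_A F"
    using Sup_extension_params rho_A_eq_Sup by (auto simp: extension_params_def)
qed

lemma extends_to_continuation:
  assumes "1 < rho_A F" shows "extends_to F (continuation F) (rho_A F)"
proof -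
  have "\<exists>g. extends_to F g (rho_A F)"
    using assms Sup_extension_params[of F] rho_A_eq_Sup[of F]
    by (auto simp: rho_A_gt_1_iff extension_params_def)
  then show ?thesis unfolding continuation_def by (rule someI_ex)
qed

lemma rho_A_eqI:
  assumes "1 < R" "extends_to F g (ereal R)"
    and "z \<in> frontier (bernstein_ellipse (ereal R))"
    and "\<not> analytic_at_rel g (bernstein_ellipse (ereal R)) z"
  shows "rho_A F = ereal R"
proof -
  have "ereal R \<in> extension_params F"
    using assms by (auto simp: extension_params_def one_ereal_def)
  moreover from this have "Sup (extension_params F) \<in> extension_params F"
    by (intro Sup_extension_params) auto
  then have "\<not> ereal R < Sup (extension_params F)"
    using extension_params_frontier_analytic assms by blast
  ultimately show ?thesis
    using rho_A_eq_Sup[of F] Sup_upper[of "ereal R" "extension_params F"] by force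
qed

lemma extends_to_cong:
  assumes "\<And>x. x \<in> {-1..1} \<Longrightarrow> F x = F' x" shows "extends_to F = extends_to F'"
  using assms by (auto simp: extends_to_def fun_eq_iff)

text \<open>Values outside [-1,1] are arbitrary, so agreement on the segment must be carried through
  the choice in \<open>continuation\<close> and the descriptions of the radii.\<close>

lemma rho_cong:
  assumes "\<And>x. x \<in> {-1..1} \<Longrightarrow> F x = F' x"
  shows "rho_A F = rho_A F'" "rho_hat F = rho_hat F'"
proof -
  have an: "analytic_at_pt F x = analytic_at_pt F' x" for x
  proof -
    have "(\<forall>w\<in>ball (complex_of_real x) e \<inter> of_real ` {-1..1}. h w = complex_of_real (F (Re w)))
      \<longleftrightarrow> (\<forall>w\<in>ball (of_real x) e \<inter> of_real ` {-1..1}. h w = complex_of_real (F' (Re w)))" for e h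
      using assms by auto
    then show ?thesis by (simp only: analytic_at_pt_def analytic_at_rel_def)
  qed
  have ext: "extends_to F = extends_to F'" using assms by (rule extends_to_cong)
  show A: "rho_A F = rho_A F'" by (simp add: rho_A_def an ext)
  have "continuation F = continuation F'" by (simp add: continuation_def A ext)
  then have "inf_Re F = inf_Re F'" by (simp add: inf_Re_def fun_eq_iff)
  then show "rho_hat F = rho_hat F'" by (simp add: rho_hat_def rho_0_def A)
qed

section \<open>The radius of positivity\<close>

locale positive_real_function =
  fixes F :: "real \<Rightarrow> real"
  assumes rho_A_gt_1: "1 < rho_A F"
    and positive: "\<And>x. x \<in> {-1..1} \<Longrightarrow> 0 < F x"
    and nonconst: "F (- 1) \<noteq> F 1"
begin

abbreviation g where "g \<equiv> continuation F"
abbreviation A where "A \<equiv> rho_A F"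

lemma continuation_holomorphic: "g holomorphic_on bernstein_ellipse A"
  and continuation_of_real: "x \<in> {-1..1} \<Longrightarrow> g (of_real x) = of_real (F x)"
  using extends_to_continuation[OF rho_A_gt_1] by (auto simp: extends_to_def)

lemma Re_continuation_continuous: "continuous_on (bernstein_ellipse A) (\<lambda>u. Re (g u))"
  by (intro continuous_intros holomorphic_on_imp_continuous_on continuation_holomorphic)

lemma closed_ellipse_subset: "1 < R \<Longrightarrow> ereal R < \<rho> \<Longrightarrow> {u. ell_param u \<le> R} \<subseteq> bernstein_ellipse \<rho>"
  using order.strict_trans[of 1 "ereal R" \<rho>] order_le_less_trans[of "ereal _" "ereal R" \<rho>]
  by (auto simp: bernstein_ellipse_eq one_ereal_def)

lemma inf_Re_nonneg_iff: "0 \<le> inf_Re F \<rho> \<longleftrightarrow> (\<forall>u\<in>bernstein_ellipse \<rho>. 0 \<le> Re (g u))"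
  by (simp add: inf_Re_def le_INF_iff)

text \<open>\<open>rho_hat F\<close> will turn out to be a member of this set; its supremum serves
  as the witness when the infimum on the full ellipse is negative.\<close>

definition nonneg_params where
  "nonneg_params = {\<rho>. 1 < \<rho> \<and> \<rho> \<le> A \<and> (\<forall>u\<in>bernstein_ellipse \<rho>. 0 \<le> Re (g u))}"

lemma enlarge_positive:
  assumes "1 \<le> R" "ereal R < A" "\<And>u. ell_param u \<le> R \<Longrightarrow> u \<in> bernstein_ellipse A \<and> 0 < Re (g u)"
  shows "\<exists>\<rho>\<in>nonneg_params. ereal R < \<rho>"
proof -
  define U where "U = bernstein_ellipse A \<inter> (\<lambda>u. Re (g u)) -` {0<..}"
  have "open U"
    unfolding U_def using open_convex_bernstein_ellipse(1)[OF rho_A_gt_1]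
    by (intro continuous_open_preimage Re_continuation_continuous) auto
  moreover have "{u. ell_param u \<le> R} \<subseteq> U" using assms(3) by (auto simp: U_def)
  ultimately obtain R' where R': "R < R'" "bernstein_ellipse (ereal R') \<subseteq> U"
    using bernstein_ellipse_enlarge[OF assms(1)] by metis
  define \<rho> where "\<rho> = min (ereal R') A"
  have "1 < ereal R'" using assms(1) R'(1) by (simp add: one_ereal_def)
  then have \<rho>: "1 < \<rho>" "\<rho> \<le> A" "ereal R < \<rho>" "\<rho> \<le> ereal R'"
    using rho_A_gt_1 R' assms(2) by (auto simp: \<rho>_def)
  then have "bernstein_ellipse \<rho> \<subseteq> U" using R'(2) bernstein_ellipse_mono by blast
  then have "\<rho> \<in> nonneg_params" using \<rho> by (auto simp: nonneg_params_def U_def less_imp_le subset_iff)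
  then show ?thesis using \<rho> by blast
qed

lemma Sup_nonneg_params: "Sup nonneg_params \<in> nonneg_params"
proof -
  have "\<exists>\<rho>\<in>nonneg_params. ereal 1 < \<rho>"
  proof (rule enlarge_positive)
    show "ereal 1 < A" using rho_A_gt_1 by (simp add: one_ereal_def)
    fix u assume "ell_param u \<le> 1"
    then have "u \<in> of_real ` {-1..1}" using ell_param_eq_1D ell_param_ge_1 by (metis order_antisym)
    then show "u \<in> bernstein_ellipse A \<and> 0 < Re (g u)"
      using real_in_bernstein_ellipse[OF rho_A_gt_1] continuation_of_real positive by auto
  qed simp
  then have ne: "nonneg_params \<noteq> {}" by auto
  have gt1: "\<And>\<rho>. \<rho> \<in> nonneg_params \<Longrightarrow> 1 < \<rho>" by (simp add: nonneg_params_def)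
  note Sup = bernstein_ellipse_Sup[OF ne gt1]
  have "Sup nonneg_params \<le> A" by (rule Sup_least) (simp add: nonneg_params_def)
  then show ?thesis using Sup by (auto simp: nonneg_params_def)
qed

text \<open>Uniqueness for \<open>rho_0\<close>. On the smaller closed ellipse the infimum 0 is
  attained, at an interior point of the larger one, which the open mapping theorem forbids for a
  nonconstant function with nonnegative real part.\<close>

lemma inf_Re_eq_0_unique:
  assumes "1 < \<rho>\<^sub>1" "\<rho>\<^sub>1 < \<rho>\<^sub>2" "\<rho>\<^sub>2 \<le> A" "inf_Re F \<rho>\<^sub>1 = 0" "inf_Re F \<rho>\<^sub>2 = 0"
  shows False
proof -
  obtain R where R: "\<rho>\<^sub>1 = ereal R" "1 < R"
    using assms(1,2) by (cases \<rho>\<^sub>1) (auto simp: one_ereal_def)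
  let ?E = "bernstein_ellipse \<rho>\<^sub>2"
  have gt1: "1 < \<rho>\<^sub>2" using assms by order
  have sub: "?E \<subseteq> bernstein_ellipse A" using gt1 assms(3) by (rule bernstein_ellipse_mono)
  have cl: "{u. ell_param u \<le> R} \<subseteq> ?E"
    using closed_ellipse_subset R assms(2) by auto
  have "\<exists>u\<^sub>0\<in>{u. ell_param u \<le> R}. \<forall>u\<in>{u. ell_param u \<le> R}. Re (g u\<^sub>0) \<le> Re (g u)"
  proof (rule continuous_attains_inf)
    show "compact {u. ell_param u \<le> R}" using R by (intro compact_ell_param_le) auto
    have "ell_param (of_real 0) \<le> R" using R by (subst ell_param_real) auto
    then show "{u. ell_param u \<le> R} \<noteq> {}" by blast
    show "continuous_on {u. ell_param u \<le> R} (\<lambda>u. Re (g u))"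
      using Re_continuation_continuous cl sub by (meson continuous_on_subset)
  qed
  then obtain u\<^sub>0 where u0: "ell_param u\<^sub>0 \<le> R" "\<And>u. ell_param u \<le> R \<Longrightarrow> Re (g u\<^sub>0) \<le> Re (g u)"
    by auto
  have "u\<^sub>0 \<in> ?E" using cl u0(1) by blast
  have nonneg: "0 \<le> Re (g u)" if "u \<in> ?E" for u
    using assms(5) inf_Re_nonneg_iff[of \<rho>\<^sub>2] that by simp
  have "ereal (Re (g u\<^sub>0)) \<le> inf_Re F \<rho>\<^sub>1"
    unfolding inf_Re_def by (rule INF_greatest) (use u0 R in \<open>auto simp: bernstein_ellipse_real\<close>)
  then have z: "Re (g u\<^sub>0) = 0" using assms(4) nonneg[OF \<open>u\<^sub>0 \<in> ?E\<close>] by simp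
  have "open (g ` ?E)"
  proof (rule open_mapping_thm[of g ?E])
    show "g holomorphic_on ?E" using continuation_holomorphic sub by (rule holomorphic_on_subset)
    show "\<not> g constant_on ?E"
    proof
      assume "g constant_on ?E"
      then have "g (of_real (- 1)) = g (of_real 1)"
        using real_in_bernstein_ellipse[OF gt1, of "- 1"] real_in_bernstein_ellipse[OF gt1, of 1]
        unfolding constant_on_def by fastforce
      then show False using continuation_of_real[of "- 1"] continuation_of_real[of 1] nonconst by (metis atLeastAtMost_iff
            neg_le_iff_le of_real_eq_iff order_refl zero_le_one neg_le_0_iff_le order_trans)
    qed
  qed (use open_convex_bernstein_ellipse connected_bernstein_ellipse gt1 in auto)
  then obtain e where e: "e > 0" "ball (g u\<^sub>0) e \<subseteq> g ` ?E"
    using \<open>u\<^sub>0 \<in> ?E\<close> open_contains_ball by blast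
  \<comment> \<open>A value slightly to the left of the imaginary axis, still inside the open
    image.\<close>
  have "g u\<^sub>0 - of_real (e / 2) \<in> ball (g u\<^sub>0) e" using e(1) by (simp add: dist_norm del: of_real_divide)
  then obtain u where "u \<in> ?E" "g u\<^sub>0 - of_real (e / 2) = g u" using e(2) by blast
  then have "Re (g u) = - (e / 2)" using z by (metis Re_complex_of_real diff_0 minus_complex.sel(1))
  with nonneg[OF \<open>u \<in> ?E\<close>] e(1) show False by simp
qed

text \<open>In the negative case the largest nonnegative parameter T has infimum exactly 0: a
  positive lower bound would persist on the closed ellipse and allow an enlargement beyond
  T.\<close>

lemma rho_hat_mem: "rho_hat F \<in> nonneg_params"
proof (cases "0 \<le> inf_Re F A")
  case True
  then show ?thesis using rho_A_gt_1 by (simp add: rho_hat_def nonneg_params_def inf_Re_nonneg_iff)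
next
  case False
  define T where "T = Sup nonneg_params"
  have T: "1 < T" "T \<le> A" "\<And>u. u \<in> bernstein_ellipse T \<Longrightarrow> 0 \<le> Re (g u)"
    using Sup_nonneg_params by (auto simp: T_def nonneg_params_def)
  have "T \<noteq> A" using T(3) False by (auto simp: inf_Re_nonneg_iff)
  with T have TA: "T < A" by simp
  then obtain R where R: "T = ereal R" "1 < R"
    using T(1) by (cases T) (auto simp: one_ereal_def)
  have "inf_Re F T = 0"
  proof (rule ccontr)
    assume "inf_Re F T \<noteq> 0"
    moreover have "0 \<le> inf_Re F T" using T(3) by (simp add: inf_Re_nonneg_iff)
    ultimately have "0 < inf_Re F T" by simp
    then obtain c where c: "0 < ereal c" "ereal c < inf_Re F T" using ereal_dense2 by blast
    have le: "c \<le> Re (g u)" if "u \<in> bernstein_ellipse T" for u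
      using c(2) that less_INF_D[of "ereal c" "\<lambda>u. ereal (Re (g u))"] by (auto simp: inf_Re_def less_imp_le)
    have cl: "closure (bernstein_ellipse T) \<subseteq> bernstein_ellipse A"
      using closed_ellipse_subset[OF R(2)] TA R by (simp add: closure_bernstein_ellipse)
    have "\<exists>\<rho>\<in>nonneg_params. ereal R < \<rho>"
    proof (rule enlarge_positive)
      show "ereal R < A" using TA R by simp
      fix u assume "ell_param u \<le> R"
      then have u: "u \<in> closure (bernstein_ellipse T)"
        using R by (simp add: closure_bernstein_ellipse)
      have "c \<le> Re (g u)"
        by (rule continuous_ge_on_closure[OF continuous_on_subset[OF Re_continuation_continuous cl] u le])
      then show "u \<in> bernstein_ellipse A \<and> 0 < Re (g u)" using c(1) u cl by auto
    qed (use R in simp)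
    then show False using Sup_upper[of _ nonneg_params] R(1) by (metis T_def leD)
  qed
  then have "rho_0 F = T"
    unfolding rho_0_def using T(1) TA inf_Re_eq_0_unique
    by (intro the_equality) (auto, metis less_imp_le linorder_less_linear)
  then show ?thesis using False T by (simp add: rho_hat_def nonneg_params_def)
qed

lemma rho_hat_props:
  "1 < rho_hat F" "rho_hat F \<le> rho_A F"
  "u \<in> bernstein_ellipse (rho_hat F) \<Longrightarrow> 0 \<le> Re (continuation F u)"
  using rho_hat_mem by (auto simp: nonneg_params_def)

lemma rho_hat_eq_rho_A:
  assumes "\<And>u. u \<in> bernstein_ellipse (rho_A F) \<Longrightarrow> 0 \<le> Re (continuation F u)"
  shows "rho_hat F = rho_A F"
  using assms by (simp add: rho_hat_def inf_Re_nonneg_iff)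

end

section \<open>The extremal function\<close>

context complementary_moduli
begin

lemma k_eq_sqrt: "k = sqrt (1 - l\<^sup>2)"
  using k_pos moduli_sum by (intro real_sqrt_unique[symmetric]) auto

definition period_ratio :: real where "period_ratio = ellipK k / pi"
definition zeta :: "complex \<Rightarrow> complex" where "zeta z = cdn (of_real period_ratio * z)"
text \<open>In the notation of the theorem this is 1/q: its logarithm is the height at which the
  scaled strip meets the pole line Im w = K(l).\<close>

definition inv_nome :: real where "inv_nome = exp (ellipK l / period_ratio)"

lemma period_ratio_pos [simp]: "0 < period_ratio" by (simp add: period_ratio_def)

lemma period_ratio_nonzero [simp]: "period_ratio \<noteq> 0"
  using period_ratio_pos by linarith

lemma inv_nome_gt_1: "1 < inv_nome" and inv_nome_gt_1_ereal: "1 < ereal inv_nome"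
  by (simp_all add: inv_nome_def one_ereal_def)

lemma Phi_eq: "Phi l u = zeta (Arccos u)"
  unfolding Phi_def Let_def k_eq_sqrt[symmetric] jacobi_dn_eq_cdn zeta_def period_ratio_def by simp

lemma zeta_minus: "zeta (- z) = zeta z"
  by (simp add: zeta_def cdn_minus)

lemma zeta_add_2pi_int: "zeta (z + of_real (2 * of_int n * pi)) = zeta z"
proof -
  have step: "zeta (z + of_real (2 * pi)) = zeta z" for z
    using cdn_add_2K[of "of_real period_ratio * z"] by (simp add: zeta_def period_ratio_def distrib_left mult_ac)
  show ?thesis
  proof (induction n rule: int_induct[where k = 0])
    case (step1 i)
    then show ?case using step[of "z + of_real (2 * of_int i * pi)"] by (simp add: algebra_simps)
  next
    case (step2 i)
    then show ?case using step[of "z + of_real (2 * of_int (i - 1) * pi)"] by (simp add: algebra_simps)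
  qed simp
qed

text \<open>Preimages under the cosine differ by sign and multiples of 2 pi, which scale to the
  symmetries of dn. The cuts of the arccosine thus leave no trace.\<close>

lemma Phi_cos: "Phi l (cos z) = zeta z"
proof -
  have "cos (Arccos (cos z)) = cos z" by simp
  then obtain m :: int where "Arccos (cos z) = z + of_real (2 * of_int m * pi)
      \<or> Arccos (cos z) = - z + of_real (2 * of_int m * pi)"
    unfolding complex_cos_eq Ints_def by auto
  then show ?thesis
    unfolding Phi_eq by (metis zeta_add_2pi_int zeta_minus)
qed

lemma zeta_strip:
  assumes "exp \<bar>Im z\<bar> < inv_nome" shows "\<bar>Im (of_real period_ratio * z)\<bar> < ellipK l"
proof -
  have "\<bar>Im z\<bar> < ellipK l / period_ratio" using assms by (simp add: inv_nome_def)
  then show ?thesis by (simp add: abs_mult less_imp_le mult.commute pos_less_divide_eq)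
qed

abbreviation E where "E \<equiv> bernstein_ellipse (ereal inv_nome)"

lemma E_eq: "E = {u. ell_param u < inv_nome}"
  by (rule bernstein_ellipse_real[OF inv_nome_gt_1])

lemma E_properties: "open E" "convex E" "connected E" "x \<in> {-1..1} \<Longrightarrow> of_real x \<in> E"
  using open_convex_bernstein_ellipse connected_bernstein_ellipse real_in_bernstein_ellipse
    inv_nome_gt_1_ereal by blast+

lemma E_cases:
  assumes "u \<in> E" obtains z where "u = cos z" "exp \<bar>Im z\<bar> < inv_nome" "\<bar>Re z\<bar> \<le> pi"
  using assms Re_Arccos_bound[of u] that[of "Arccos u"] by (simp add: E_eq ell_param_def)

definition strip :: "complex set" where "strip = {z. exp \<bar>Im z\<bar> < inv_nome}"

lemma open_strip: "open strip"
  unfolding strip_def by (intro open_Collect_less continuous_intros)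

lemma zeta_holomorphic: "zeta holomorphic_on strip"
proof -
  have "(\<lambda>z. of_real period_ratio * z) ` strip \<subseteq> {w. cdn_den w \<noteq> 0}"
  proof clarify
    fix z assume "z \<in> strip" "cdn_den (of_real period_ratio * z) = 0"
    then show False using cdn_den_pos_strip[OF zeta_strip[of z]] by (simp add: strip_def)
  qed
  then have "cdn holomorphic_on (\<lambda>z. of_real period_ratio * z) ` strip"
    by (rule holomorphic_on_subset[OF cdn_analytic[THEN analytic_imp_holomorphic]])
  then have "(cdn \<circ> (\<lambda>z. of_real period_ratio * z)) holomorphic_on strip"
    by (intro holomorphic_on_compose holomorphic_intros)
  then show ?thesis by (simp add: zeta_def[abs_def] o_def)
qed

lemma open_cos_image:
  assumes "open U" shows "open (cos ` (U :: complex set))"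
proof (rule open_mapping_thm[of cos UNIV])
  show "\<not> (cos :: complex \<Rightarrow> complex) constant_on UNIV"
  proof
    assume "(cos :: complex \<Rightarrow> complex) constant_on UNIV"
    then have "cos (0::complex) = cos (of_real pi)" unfolding constant_on_def by (metis UNIV_I)
    then show False by (simp add: cos_of_real)
  qed
qed (use assms in \<open>auto intro: holomorphic_intros\<close>)

text \<open>Continuity across the cuts of the arccosine comes from the openness of the cosine, and
  holomorphy away from the critical values \<open>\<plusminus>1\<close> from its local inverses.\<close>

lemma Phi_holomorphic: "Phi l holomorphic_on E"
\<comment> \<open>Riemann's theorem fills in the points -1 and 1, where the cosine has no local
  inverse.\<close>
proof (rule no_isolated_singularity)
  show "continuous_on E (Phi l)"
    unfolding continuous_on_open_vimage[OF E_properties(1)]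
  proof (intro allI impI)
    fix V :: "complex set" assume "open V"
    have "Phi l -` V \<inter> E = cos ` (strip \<inter> zeta -` V)"
    proof
      show "Phi l -` V \<inter> E \<subseteq> cos ` (strip \<inter> zeta -` V)"
        by (auto simp: strip_def Phi_cos elim!: E_cases)
      show "cos ` (strip \<inter> zeta -` V) \<subseteq> Phi l -` V \<inter> E"
        by (auto simp: strip_def Phi_cos E_eq)
    qed
    moreover have "open (strip \<inter> zeta -` V)"
      using holomorphic_on_imp_continuous_on[OF zeta_holomorphic] open_strip \<open>open V\<close>
      by (rule continuous_open_preimage)
    ultimately show "open (Phi l -` V \<inter> E)" by (simp add: open_cos_image)
  qed
  show "Phi l holomorphic_on E - {- 1, 1}"
  proof -
    have "\<exists>T. open T \<and> u \<in> T \<and> Phi l holomorphic_on T" if u: "u \<in> E - {- 1, 1}" for u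
    proof -
      obtain z where z: "u = cos z" "z \<in> strip"
        using u by (auto simp: strip_def elim: E_cases)
      have "(sin z)\<^sup>2 \<noteq> 0"
      proof
        assume "(sin z)\<^sup>2 = 0"
        then have "u\<^sup>2 = 1" by (simp add: z cos_squared_eq)
        then show False using u by (auto simp: power2_eq_1_iff)
      qed
      then have "deriv cos z \<noteq> 0" by (simp add: DERIV_imp_deriv[OF DERIV_cos])
      then obtain d where d: "d > 0" "ball z d \<subseteq> strip" "inj_on cos (ball z d)"
        using has_complex_derivative_locally_injective[of cos strip z] open_strip z
        by (metis holomorphic_on_cos holomorphic_on_ident)
      obtain g where g: "g holomorphic_on cos ` ball z d" "\<And>w. w \<in> ball z d \<Longrightarrow> g (cos w) = w"
        using holomorphic_has_inverse[of cos "ball z d"] d(3)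
        by (metis holomorphic_on_cos holomorphic_on_ident open_ball)
      have "zeta \<circ> g holomorphic_on cos ` ball z d"
      proof (rule holomorphic_on_compose[OF g(1)])
        have "g ` cos ` ball z d \<subseteq> strip" using g(2) d(2) by auto
        then show "zeta holomorphic_on g ` cos ` ball z d"
          by (rule holomorphic_on_subset[OF zeta_holomorphic])
      qed
      then have "Phi l holomorphic_on cos ` ball z d"
        by (rule holomorphic_transform) (auto simp: g(2) Phi_cos)
      moreover have "open (cos ` ball z d)" "u \<in> cos ` ball z d"
        using d(1) z by (auto intro: open_cos_image)
      ultimately show ?thesis by blast
    qed
    then show ?thesis
      by (meson E_properties(1) finite.emptyI finite.insertI finite_imp_closed holomorphic_on_imp_differentiable_at
          holomorphic_onI field_differentiable_at_within)
  qed
qed (auto simp: E_properties)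

section \<open>Phi as an admissible function, and its radius of analyticity\<close>

lemma Re_Phi_pos: "u \<in> E \<Longrightarrow> 0 < Re (Phi l u)"
  by (auto simp: Phi_cos zeta_def intro!: Re_cdn_pos zeta_strip elim!: E_cases)

lemma Phi_of_real:
  assumes "x \<in> {-1..1}" shows "Phi l (of_real x) = of_real (K.dn (period_ratio * arccos x))"
proof -
  have "Arccos (of_real x) = of_real (arccos x)" using assms by (intro of_real_arccos[symmetric]) auto
  then show ?thesis by (simp add: Phi_eq zeta_def cdn_of_real flip: of_real_mult)
qed

lemma Phi_real_eq: "x \<in> {-1..1} \<Longrightarrow> Phi_real l x = K.dn (period_ratio * arccos x)"
  by (simp only: Phi_real_def Phi_of_real Re_complex_of_real)

lemma Phi_of_real_eq: "x \<in> {-1..1} \<Longrightarrow> Phi l (of_real x) = of_real (Phi_real l x)"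
  by (simp only: Phi_real_eq Phi_of_real)

lemma Phi_real_F_class: "Phi_real l \<in> F_class l"
proof -
  have "continuous_on {-1..1} (\<lambda>x. Re (Phi l (of_real x)))"
    by (rule continuous_on_Re[OF continuous_on_compose2[OF holomorphic_on_imp_continuous_on[OF Phi_holomorphic]
          continuous_on_of_real_id]]) (blast intro: E_properties(4))
  moreover have "strict_mono_on {-1..1} (Phi_real l)"
  proof (rule strict_mono_onI)
    fix x y :: real assume xy: "x \<in> {-1..1}" "y \<in> {-1..1}" "x < y"
    have "K.dn (period_ratio * arccos x) < K.dn (period_ratio * arccos y)"
    proof (rule K.dn_strict_decreasing)
      show "0 \<le> period_ratio * arccos y" using xy by (simp add: arccos_lbound zero_le_mult_iff less_imp_le)
      show "period_ratio * arccos y < period_ratio * arccos x" using xy by (simp add: arccos_less_arccos)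
      have "period_ratio * arccos x \<le> period_ratio * pi" using xy by (simp add: arccos_ubound)
      then show "period_ratio * arccos x \<le> ellipK k" by (simp add: period_ratio_def)
    qed (use k_pos in simp)
    then show "Phi_real l x < Phi_real l y" using xy by (simp only: Phi_real_eq)
  qed
  \<comment> \<open>The scaled value of arccos (-1) is K(k), where dn takes its minimum, the
    complementary modulus.\<close>
  moreover have "Phi_real l (- 1) = l"
    using l_pos moduli_sum by (simp add: Phi_real_eq period_ratio_def K.dn_K real_sqrt_unique)
  moreover have "Phi_real l 1 = 1" by (simp add: Phi_real_eq)
  ultimately show ?thesis by (simp add: F_class_def Phi_real_def[abs_def])
qed

lemma extends_to_Phi: "extends_to (Phi_real l) (Phi l) (ereal inv_nome)"
  using Phi_holomorphic Phi_of_real_eq by (auto simp: extends_to_def)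

text \<open>The pole of \<open>dn\<close> at \<open>\<i> K(l)\<close> lies over the right vertex of the ellipse.\<close>

lemma Phi_not_analytic_at_vertex:
  "\<not> analytic_at_rel (Phi l) E (cos (\<i> * of_real (ln inv_nome)))"
proof
  define y\<^sub>0 where "y\<^sub>0 = ln inv_nome"
  have y0: "y\<^sub>0 = ellipK l / period_ratio" "0 < y\<^sub>0" by (simp_all add: y\<^sub>0_def inv_nome_def)
  let ?u = "cos (\<i> * of_real y\<^sub>0)"
  assume "analytic_at_rel (Phi l) E (cos (\<i> * of_real (ln inv_nome)))"
  then obtain e h where e: "e > 0" and h: "h holomorphic_on ball ?u e"
    and eq: "\<And>w. w \<in> ball ?u e \<Longrightarrow> w \<in> E \<Longrightarrow> h w = Phi l w"
    by (auto simp: analytic_at_rel_def y\<^sub>0_def)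
  \<comment> \<open>The vertex is approached from inside the ellipse along the image of the
    imaginary axis: the extension h would have a finite limit there, dn an infinite one.\<close>
  have "((\<lambda>y. cos (\<i> * complex_of_real y)) \<longlongrightarrow> ?u) (at_left y\<^sub>0)"
    by (intro tendsto_intros)
  moreover have "isCont h ?u"
    using holomorphic_on_imp_continuous_on[OF h] e by (simp add: continuous_on_eq_continuous_at)
  ultimately have lim: "((\<lambda>y. h (cos (\<i> * of_real y))) \<longlongrightarrow> h ?u) (at_left y\<^sub>0)"
    using isCont_tendsto_compose by blast
  have "eventually (\<lambda>y. cos (\<i> * complex_of_real y) \<in> ball ?u e) (at_left y\<^sub>0)"
    using \<open>((\<lambda>y. cos (\<i> * complex_of_real y)) \<longlongrightarrow> ?u) (at_left y\<^sub>0)\<close> e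
    by (intro topological_tendstoD) auto
  moreover have "eventually (\<lambda>y. y \<in> {0<..<y\<^sub>0}) (at_left y\<^sub>0)"
    using y0 by (intro eventually_at_leftI[of 0]) auto
  ultimately have "eventually (\<lambda>y. h (cos (\<i> * of_real y)) = cdn (\<i> * of_real (period_ratio * y))) (at_left y\<^sub>0)"
  proof eventually_elim
    case (elim y)
    have "exp y < inv_nome" using elim(2) by (simp add: y0 inv_nome_def)
    then have "cos (\<i> * complex_of_real y) \<in> E" using elim(2) by (simp add: E_eq)
    then show ?case using elim(1) eq by (simp add: Phi_cos zeta_def mult_ac)
  qed
  with lim have lim': "((\<lambda>y. cdn (\<i> * of_real (period_ratio * y))) \<longlongrightarrow> h ?u) (at_left y\<^sub>0)"
    using tendsto_cong by fast
  have "is_pole cdn (\<i> * of_real (period_ratio * y\<^sub>0))"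
    by (rule cdn_pole) (simp add: cdn_den_def y0)
  moreover have "filterlim (\<lambda>y. \<i> * complex_of_real (period_ratio * y)) (at (\<i> * of_real (period_ratio * y\<^sub>0))) (at_left y\<^sub>0)"
    unfolding filterlim_at
  proof
    show "eventually (\<lambda>y. \<i> * complex_of_real (period_ratio * y) \<in> UNIV \<and>
        \<i> * complex_of_real (period_ratio * y) \<noteq> \<i> * complex_of_real (period_ratio * y\<^sub>0)) (at_left y\<^sub>0)"
      using \<open>eventually (\<lambda>y. y \<in> {0<..<y\<^sub>0}) (at_left y\<^sub>0)\<close>
      by eventually_elim (use period_ratio_pos in auto)
    show "((\<lambda>y. \<i> * complex_of_real (period_ratio * y)) \<longlongrightarrow> \<i> * complex_of_real (period_ratio * y\<^sub>0)) (at_left y\<^sub>0)"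
      by (intro tendsto_intros)
  qed
  ultimately have "filterlim (\<lambda>y. cdn (\<i> * of_real (period_ratio * y))) at_infinity (at_left y\<^sub>0)"
    unfolding is_pole_def by (rule filterlim_compose)
  with lim' show False
    by (intro not_tendsto_and_filterlim_at_infinity) auto
qed

lemma rho_A_Phi_real: "rho_A (Phi_real l) = ereal inv_nome"
proof (rule rho_A_eqI[OF inv_nome_gt_1 extends_to_Phi _ Phi_not_analytic_at_vertex])
  show "cos (\<i> * of_real (ln inv_nome)) \<in> frontier E"
    using inv_nome_gt_1 by (simp add: frontier_bernstein_ellipse)
qed

lemma Phi_real_admissible: "Phi_real l \<in> admissible l"
  using Phi_real_F_class inv_nome_gt_1_ereal by (simp add: admissible_def rho_A_Phi_real)

text \<open>The rectangle |Re z| \<le> pi scales to |Re w| \<le> K(k), where sn vanishes only at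
  0.\<close>

lemma Phi_eq_1D:
  assumes "u \<in> E" "Phi l u = 1" shows "u = 1"
proof -
  obtain z where z: "u = cos z" "exp \<bar>Im z\<bar> < inv_nome" "\<bar>Re z\<bar> \<le> pi" using assms(1) by (rule E_cases)
  have "cdn (of_real period_ratio * z) = 1" using assms(2) z by (simp add: Phi_cos zeta_def)
  then have *: "K.sn (Re (of_real period_ratio * z)) = 0" "Im (of_real period_ratio * z) = 0"
    using cdn_eq_1_iff[OF zeta_strip[OF z(2)]] by auto
  have "\<bar>Re (of_real period_ratio * z)\<bar> \<le> ellipK k"
  proof -
    have "\<bar>Re (of_real period_ratio * z)\<bar> = period_ratio * \<bar>Re z\<bar>"
      by (simp add: abs_mult less_imp_le)
    also have "\<dots> \<le> period_ratio * pi" using z(3) by simp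
    finally show ?thesis by (simp add: period_ratio_def)
  qed
  then have "Re (of_real period_ratio * z) = 0" by (rule K.sn_eq_0D[OF *(1)])
  then have "of_real period_ratio * z = 0" using *(2) by (simp only: complex_eq_iff) simp
  then have "z = 0" using period_ratio_pos by simp
  then show ?thesis using z by simp
qed

text \<open>The zero at 1 is simple. Since 1 is a critical value of the cosine, the chain rule is
  empty there; the second-order terms of dn and cos at 0 are compared instead and give (k K(k) /
  pi)^2.\<close>

lemma deriv_Phi_1: "deriv (Phi l) 1 \<noteq> 0"
proof -
  have "1 \<in> E" using E_properties(4)[of 1] by simp
  then have "(Phi l has_field_derivative deriv (Phi l) 1) (at 1)"
    using Phi_holomorphic E_properties(1) holomorphic_derivI by blast
  then have "((\<lambda>u. (Phi l u - Phi l 1) / (u - 1)) \<longlongrightarrow> deriv (Phi l) 1) (at 1)"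
    by (simp add: has_field_derivative_iff)
  moreover have ev0: "eventually (\<lambda>t::real. t \<in> {- pi<..<pi} - {0}) (at 0)"
    by (rule eventually_at_in_open) auto
  have "filterlim (\<lambda>t::real. complex_of_real (cos t)) (at 1) (at 0)"
    unfolding filterlim_at
  proof
    have "((\<lambda>t::real. complex_of_real (cos t)) \<longlongrightarrow> complex_of_real (cos 0)) (at 0)"
      by (intro tendsto_intros)
    then show "((\<lambda>t::real. complex_of_real (cos t)) \<longlongrightarrow> 1) (at 0)" by simp
    show "eventually (\<lambda>t::real. complex_of_real (cos t) \<in> UNIV \<and> complex_of_real (cos t) \<noteq> 1) (at 0)"
      using ev0
    proof eventually_elim
      case (elim t)
      then have "sin t \<noteq> 0" using sin_eq_0_pi[of t] by auto
      then have "cos t \<noteq> 1" using sin_squared_eq[of t] by auto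
      then show ?case by simp
    qed
  qed
  ultimately have lim1: "((\<lambda>t::real. (Phi l (of_real (cos t)) - Phi l 1) / (of_real (cos t) - 1))
      \<longlongrightarrow> deriv (Phi l) 1) (at 0)"
    by (rule filterlim_compose)
  \<comment> \<open>The difference quotient after rationalizing 1 - dn = k^2 sn^2 / (1 + dn) and 1 -
    cos = sin^2 / (1 + cos), with numerator and denominator divided by t^2.\<close>
  let ?q = "\<lambda>t. k\<^sup>2 * ((K.sn (period_ratio * t) / t) / (sin t / t))\<^sup>2 * ((1 + cos t) / (1 + K.dn (period_ratio * t)))"
  have "((\<lambda>t. K.sn (period_ratio * t)) has_real_derivative K.cn (period_ratio * 0) * K.dn (period_ratio * 0) * period_ratio) (at 0)"
    by (rule DERIV_chain2[OF K.sn_DERIV]) (auto intro!: derivative_eq_intros)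
  then have sn: "((\<lambda>t. K.sn (period_ratio * t) / t) \<longlongrightarrow> period_ratio) (at 0)"
    by (simp add: has_field_derivative_iff)
  have sin: "((\<lambda>t::real. sin t / t) \<longlongrightarrow> 1) (at 0)"
    using DERIV_sin[of "0::real"] by (simp add: has_field_derivative_iff)
  have "isCont (\<lambda>t. K.dn (period_ratio * t)) 0"
    by (intro isCont_o2[OF _ DERIV_isCont[OF K.dn_DERIV]] continuous_intros)
  then have dn: "((\<lambda>t. K.dn (period_ratio * t)) \<longlongrightarrow> 1) (at 0)" by (simp add: isCont_def)
  have cos: "((\<lambda>t::real. cos t) \<longlongrightarrow> 1) (at 0)"
    using isCont_cos[of "0::real"] by (simp add: isCont_def)
  have "(?q \<longlongrightarrow> k\<^sup>2 * (period_ratio / 1)\<^sup>2 * ((1 + 1) / (1 + 1))) (at 0)"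
    by (intro tendsto_intros sn sin dn cos) auto
  then have "((\<lambda>t. complex_of_real (?q t)) \<longlongrightarrow> of_real (k\<^sup>2 * period_ratio\<^sup>2)) (at 0)"
    by (intro tendsto_of_real) simp
  moreover have "eventually (\<lambda>t. complex_of_real (?q t)
      = (Phi l (of_real (cos t)) - Phi l 1) / (of_real (cos t) - 1)) (at 0)"
    using ev0
  proof eventually_elim
    case (elim t)
    then have t: "t \<noteq> 0" and st: "sin t \<noteq> 0" using sin_eq_0_pi[of t] by auto
    have c: "(1 - cos t) * (1 + cos t) = (sin t)\<^sup>2" by (simp add: sin_squared_eq power2_eq_square algebra_simps)
    have d: "(1 - K.dn (period_ratio * t)) * (1 + K.dn (period_ratio * t)) = k\<^sup>2 * (K.sn (period_ratio * t))\<^sup>2"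
      using K.dn_sq[of "period_ratio * t"] by (simp add: power2_eq_square algebra_simps)
    have dp: "1 + K.dn (period_ratio * t) \<noteq> 0" using K.dn_pos[of "period_ratio * t"] by linarith
    have c0: "1 - cos t \<noteq> 0" "1 + cos t \<noteq> 0" using c st by auto
    have "?q t = (k\<^sup>2 * (K.sn (period_ratio * t))\<^sup>2 / (1 + K.dn (period_ratio * t))) / ((sin t)\<^sup>2 / (1 + cos t))"
      using t st dp c0 by (simp add: power_divide)
    also have "\<dots> = (1 - K.dn (period_ratio * t)) / (1 - cos t)"
      unfolding d[symmetric] c[symmetric] using dp c0 by simp
    also have "\<dots> = (K.dn (period_ratio * t) - 1) / (cos t - 1)"
      by (metis minus_diff_eq minus_divide_divide)
    finally have q: "?q t = (K.dn (period_ratio * t) - 1) / (cos t - 1)" .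
    have "Phi l (of_real (cos t)) = of_real (K.dn (period_ratio * t))"
      using Phi_cos[of "of_real t"] by (simp add: zeta_def cos_of_real cdn_of_real flip: of_real_mult)
    moreover have "Phi l 1 = 1" using Phi_of_real[of 1] by simp
    ultimately show ?case unfolding q by simp
  qed
  ultimately have "((\<lambda>t::real. (Phi l (of_real (cos t)) - Phi l 1) / (of_real (cos t) - 1))
      \<longlongrightarrow> of_real (k\<^sup>2 * period_ratio\<^sup>2)) (at 0)"
    using tendsto_cong by fast
  with lim1 have "deriv (Phi l) 1 = of_real (k\<^sup>2 * period_ratio\<^sup>2)"
    by (intro tendsto_unique[OF _ lim1]) auto
  then show ?thesis using k_pos period_ratio_pos by (simp add: less_imp_neq[symmetric])
qed

section \<open>Rigidity of the extremal function\<close>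

lemma norm_Cayley_le_1:
  assumes "0 \<le> Re z" shows "cmod (z - 1) \<le> cmod (z + 1)"
proof (rule power2_le_imp_le)
  show "(cmod (z - 1))\<^sup>2 \<le> (cmod (z + 1))\<^sup>2"
    unfolding cmod_power2 using assms by (simp add: power2_eq_square algebra_simps)
qed simp

text \<open>Schwarz lemma for the half plane: the quotient of the Cayley transforms of \<open>p\<close> and \<open>\<Phi>\<close>
  is holomorphic, because the latter has a single, simple zero; it is bounded by 1 by the
  maximum principle, and it attains the value 1 at \<open>-1\<close>.\<close>

lemma Phi_rigidity:
  assumes p: "p holomorphic_on E" "\<And>u. u \<in> E \<Longrightarrow> 0 \<le> Re (p u)"
    and p1: "p 1 = 1" and pm1: "p (- 1) = of_real l" and u: "u \<in> E"
  shows "p u = Phi l u"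
proof -
  have in_E: "1 \<in> E" "- 1 \<in> E" using E_properties(4)[of 1] E_properties(4)[of "- 1"] by auto
  have Phi1: "Phi l 1 = 1" and Phim1: "Phi l (- 1) = of_real l"
    using Phi_of_real_eq[of 1] Phi_of_real_eq[of "- 1"] Phi_real_F_class by (auto simp: F_class_def)
  have p_nz: "p u + 1 \<noteq> 0" and Phi_nz: "Phi l u + 1 \<noteq> 0" if "u \<in> E" for u
    using p(2)[OF that] Re_Phi_pos[OF that] by (auto simp: complex_eq_iff)
  \<comment> \<open>Divided differences at 1: the common factor u - 1 of the two Cayley numerators
    is cancelled before the quotient P is formed.\<close>
  define B where "B u = (if u = 1 then deriv (Phi l) 1 else (Phi l u - Phi l 1) / (u - 1))" for u
  define C where "C u = (if u = 1 then deriv p 1 else (p u - p 1) / (u - 1))" for u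
  have B: "B holomorphic_on E" and C: "C holomorphic_on E"
    using pole_lemma_open[OF Phi_holomorphic E_properties(1)] pole_lemma_open[OF p(1) E_properties(1)]
    by (simp_all add: B_def[abs_def] C_def[abs_def])
  \<comment> \<open>The single simple zero enters here: simplicity at 1, uniqueness
    elsewhere.\<close>
  have B_nz: "B u \<noteq> 0" if "u \<in> E" for u
    using deriv_Phi_1 Phi_eq_1D[OF that] by (auto simp: B_def Phi1)
  define P where "P u = C u * (Phi l u + 1) / (B u * (p u + 1))" for u
  have P: "P holomorphic_on E"
    unfolding P_def by (intro holomorphic_intros B C Phi_holomorphic p(1)) (use B_nz p_nz in auto)
  have P_eq: "P u * ((Phi l u - 1) / (Phi l u + 1)) = (p u - 1) / (p u + 1)" if "u \<in> E" for u
  proof (cases "u = 1")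
    case False
    have "Phi l u - 1 \<noteq> 0" using Phi_eq_1D[OF that] False by auto
    moreover have "a / c * d / (b / c * e) * (b / d) = a / e"
      if "b \<noteq> 0" "c \<noteq> 0" "d \<noteq> 0" for a b c d e :: complex
      using that by (cases "e = 0") (simp_all add: field_simps)
    ultimately show ?thesis
      using False Phi_nz[OF that] by (simp add: P_def B_def C_def Phi1 p1)
  qed (simp add: Phi1 p1)
  have P_g: "cmod (P u) * cmod ((Phi l u - 1) / (Phi l u + 1)) \<le> 1" if "u \<in> E" for u
  proof -
    have "cmod ((p u - 1) / (p u + 1)) \<le> 1"
      using norm_Cayley_le_1[OF p(2)[OF that]] p_nz[OF that] by (simp add: norm_divide)
    then show ?thesis unfolding P_eq[OF that, symmetric] norm_mult .
  qed
  \<comment> \<open>Lower bound from \<open>norm_Cayley_cdn\<close> for the squared Cayley transform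
    of Phi on the ellipse of parameter exp y. It tends to 1 at the boundary, since
    \<open>L.cn\<close> vanishes at K(l); where it is not positive, the estimate for P is
    trivial.\<close>
  define b where "b y = 1 - 4 * L.cn (period_ratio * y) / k\<^sup>2" for y
  have bound: "(cmod (P u))\<^sup>2 * b y \<le> 1" if y: "0 < y" "exp y < inv_nome" and u: "ell_param u < exp y" for u y
  proof (cases "0 < b y")
    case False
    then have "(cmod (P u))\<^sup>2 * b y \<le> 0" by (simp add: mult_nonneg_nonpos)
    then show ?thesis by simp
  next
    case True
    have R: "1 < exp y" using y by simp
    let ?D = "bernstein_ellipse (ereal (exp y))"
    have cl: "closure ?D \<subseteq> E" using y by (auto simp: closure_bernstein_ellipse[OF R] E_eq)
    have "cmod (P u) \<le> 1 / sqrt (b y)"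
    proof (rule maximum_modulus_frontier[of P ?D])
      show "P holomorphic_on interior ?D" "continuous_on (closure ?D) P"
        using P cl closure_subset[of ?D] interior_subset[of ?D]
        by (auto intro: holomorphic_on_subset holomorphic_on_imp_continuous_on)
      show "bounded ?D"
        using compact_imp_bounded[OF compact_ell_param_le[OF less_imp_le[OF R]]]
        by (rule bounded_subset) (auto simp: bernstein_ellipse_real[OF R])
      show "u \<in> ?D" using u by (simp add: bernstein_ellipse_real[OF R])
      fix v assume "v \<in> frontier ?D"
      then have v: "ell_param v = exp y" by (simp add: frontier_bernstein_ellipse[OF R])
      then have "v \<in> E" using y by (simp add: E_eq)
      define w where "w = of_real period_ratio * Arccos v"
      have Iw: "\<bar>Im w\<bar> = period_ratio * y"
        using v by (simp add: w_def ell_param_def abs_mult abs_of_pos[OF period_ratio_pos])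
      have "\<bar>Im w\<bar> < ellipK l"
        unfolding w_def by (rule zeta_strip) (use v y in \<open>simp add: ell_param_def\<close>)
      note norm_Cayley_cdn[OF this]
      moreover have "L.cn (Im w) = L.cn (period_ratio * y)"
        using Iw by (metis L.cn_minus abs_if)
      moreover have "cdn w = Phi l v" by (simp add: Phi_eq zeta_def w_def)
      ultimately have "b y \<le> (cmod ((Phi l v - 1) / (Phi l v + 1)))\<^sup>2" by (simp add: b_def)
      then have "sqrt (b y) \<le> cmod ((Phi l v - 1) / (Phi l v + 1))" by (rule real_le_lsqrt[OF norm_ge_zero])
      then have "cmod (P v) * sqrt (b y) \<le> 1"
        using P_g[OF \<open>v \<in> E\<close>] by (meson mult_left_mono norm_ge_zero order_trans)
      then show "cmod (P v) \<le> 1 / sqrt (b y)" using True by (simp add: field_simps)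
    qed
    then have "(cmod (P u))\<^sup>2 \<le> (1 / sqrt (b y))\<^sup>2" by (intro power_mono) auto
    then show ?thesis using True by (simp add: power_divide field_simps)
  qed
  have P_le_1: "cmod (P u) \<le> 1" if "u \<in> E" for u
  proof -
    \<comment> \<open>For fixed u the bound holds on every ellipse around u inside \<open>E\<close>,
      so y may tend to ln (1/q) from below.\<close>
    let ?y = "ellipK l / period_ratio"
    have y: "0 < ?y" "exp ?y = inv_nome" by (simp_all add: inv_nome_def)
    have "isCont b ?y"
      unfolding b_def
      by (intro continuous_intros isCont_o2[OF _ DERIV_isCont[OF L.cn_DERIV]]) (use k_pos in auto)
    then have "((\<lambda>y. (cmod (P u))\<^sup>2 * b y) \<longlongrightarrow> (cmod (P u))\<^sup>2 * b ?y) (at_left ?y)"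
      by (intro tendsto_intros) (simp add: isCont_def filterlim_at_split)
    moreover have "ln (ell_param u) < ?y"
    proof -
      have "ell_param u < exp ?y" using that y by (simp add: E_eq)
      then have "ln (ell_param u) < ln (exp ?y)" using ell_param_ge_1[of u] by (subst ln_less_cancel_iff) auto
      then show ?thesis by simp
    qed
    then have "eventually (\<lambda>y. y \<in> {ln (ell_param u)<..<?y}) (at_left ?y)"
      by (intro eventually_at_leftI) auto
    then have "eventually (\<lambda>y. (cmod (P u))\<^sup>2 * b y \<le> 1) (at_left ?y)"
    proof eventually_elim
      case (elim t)
      have "0 \<le> ln (ell_param u)" using ell_param_ge_1 by simp
      with elim have "0 < t" by simp
      moreover have "exp (ln (ell_param u)) = ell_param u"
        using ell_param_ge_1[of u] by (intro exp_ln) linarith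
      moreover have "exp (ln (ell_param u)) < exp t" "exp t < exp ?y" using elim by auto
      ultimately show ?case using elim y by (intro bound) auto
    qed
    ultimately have "(cmod (P u))\<^sup>2 * b ?y \<le> 1"
      by (intro tendsto_upperbound) auto
    moreover have "b ?y = 1" using period_ratio_pos by (simp add: b_def)
    ultimately show ?thesis by (simp add: abs_square_le_1)
  qed
  \<comment> \<open>Makes the Cayley transform of \<open>l\<close> nonzero, so that it can be
    cancelled at -1.\<close>
  have l1: "l \<noteq> 1" using k_pos moduli_sum by auto
  have "P (- 1) * ((of_real l - 1) / (of_real l + 1)) = (of_real l - 1) / (of_real l + 1)"
    using P_eq[OF in_E(2)] by (simp only: Phim1 pm1)
  moreover have "(of_real l - 1) / (of_real l + 1) \<noteq> (0::complex)"
    using l1 p_nz[OF in_E(2)] pm1 by auto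
  ultimately have Pm1: "P (- 1) = 1" by simp
  have "P constant_on E"
    by (rule maximum_modulus_principle[OF P E_properties(1,3,1) order_refl in_E(2)])
       (use P_le_1 Pm1 in auto)
  then have "P u = 1" using Pm1 u in_E(2) unfolding constant_on_def by metis
  then have "(Phi l u - 1) / (Phi l u + 1) = (p u - 1) / (p u + 1)" using P_eq[OF u] by simp
  then show ?thesis using p_nz[OF u] Phi_nz[OF u] by (simp add: field_simps)
qed

section \<open>Maximality and the case of equality\<close>

lemma admissible_positive:
  assumes "\<psi> \<in> admissible l" shows "positive_real_function \<psi>"
proof
  show "1 < rho_A \<psi>" using assms by (simp add: admissible_def)
  have \<psi>: "strict_mono_on {-1..1} \<psi>" "\<psi> (- 1) = l" "\<psi> 1 = 1"
    using assms by (auto simp: admissible_def F_class_def)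
  show "0 < \<psi> x" if "x \<in> {-1..1}" for x
  proof -
    have "\<psi> (- 1) \<le> \<psi> x" using that by (auto intro: strict_mono_on_leD[OF \<psi>(1)])
    then show ?thesis using \<psi> l_pos by simp
  qed
  show "\<psi> (- 1) \<noteq> \<psi> 1" using \<psi> k_pos moduli_sum by auto
qed

lemma rho_hat_Phi_real: "rho_hat (Phi_real l) = ereal inv_nome"
proof -
  interpret positive_real_function "Phi_real l"
    using Phi_real_admissible by (rule admissible_positive)
  have "continuation (Phi_real l) u = Phi l u" if "u \<in> E" for u
    using extends_to_unique[OF inv_nome_gt_1_ereal _ extends_to_Phi that]
      extends_to_continuation[OF rho_A_gt_1] by (simp add: rho_A_Phi_real)
  then have "rho_hat (Phi_real l) = rho_A (Phi_real l)"
    using Re_Phi_pos by (intro rho_hat_eq_rho_A) (simp add: rho_A_Phi_real less_imp_le)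
  then show ?thesis by (simp add: rho_A_Phi_real)
qed

lemma continuation_eq_Phi_imp:
  assumes "\<psi> \<in> admissible l" "ereal inv_nome \<le> rho_A \<psi>" "\<And>u. u \<in> E \<Longrightarrow> continuation \<psi> u = Phi l u"
  shows "rho_hat \<psi> = ereal inv_nome"
proof -
  interpret positive_real_function \<psi> using assms(1) by (rule admissible_positive)
  have "\<psi> x = Phi_real l x" if "x \<in> {-1..1}" for x
    using continuation_of_real[OF that] assms(3)[OF E_properties(4)[OF that]] by (simp add: Phi_real_def)
  then show ?thesis using rho_cong(2)[of \<psi> "Phi_real l"] rho_hat_Phi_real by metis
qed

text \<open>Radii above 1/q, including infinity, are covered too: the competitor is then nonnegative
  in real part on \<open>E\<close>, which is all that rigidity uses of the radius.\<close>

lemma large_rho_hat_imp: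
  assumes "\<psi> \<in> admissible l" "ereal inv_nome \<le> rho_hat \<psi>" "u \<in> E"
  shows "continuation \<psi> u = Phi l u"
proof -
  interpret positive_real_function \<psi> using assms(1) by (rule admissible_positive)
  have sub: "E \<subseteq> bernstein_ellipse (rho_hat \<psi>)" "E \<subseteq> bernstein_ellipse (rho_A \<psi>)"
    using assms(2) rho_hat_props(2) inv_nome_gt_1_ereal by (blast intro: bernstein_ellipse_mono[THEN subsetD] order_trans)+
  have "\<psi> (- 1) = l" "\<psi> 1 = 1" using assms(1) by (auto simp: admissible_def F_class_def)
  then have "continuation \<psi> (- 1) = of_real l" "continuation \<psi> 1 = 1"
    using continuation_of_real[of "- 1"] continuation_of_real[of 1] by auto
  then show ?thesis
    using Phi_rigidity[OF holomorphic_on_subset[OF continuation_holomorphic sub(2)] _ _ _ assms(3)] rho_hat_props(3) sub(1) by blast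
qed

text \<open>A larger radius would force agreement with Phi on \<open>E\<close>, and thereby the
  radius 1/q after all.\<close>

lemma rho_hat_le:
  assumes "\<psi> \<in> admissible l" shows "rho_hat \<psi> \<le> ereal inv_nome"
proof (rule ccontr)
  assume gt: "\<not> rho_hat \<psi> \<le> ereal inv_nome"
  interpret positive_real_function \<psi> using assms by (rule admissible_positive)
  have "rho_hat \<psi> = ereal inv_nome"
    using gt rho_hat_props(2) large_rho_hat_imp[OF assms]
    by (intro continuation_eq_Phi_imp[OF assms]) auto
  with gt show False by simp
qed

text \<open>The inequality for \<open>rho_A\<close> expresses that the continuation is meaningful on
  all of \<open>E\<close>; outside its own ellipse \<open>continuation\<close> is an arbitrary
  choice.\<close>

lemma maximal_iff:
  assumes "\<phi> \<in> admissible l"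
  shows "(\<forall>\<psi>\<in>admissible l. rho_hat \<psi> \<le> rho_hat \<phi>) \<longleftrightarrow>
    ereal inv_nome \<le> rho_A \<phi> \<and> (\<forall>u\<in>E. continuation \<phi> u = Phi l u)"
proof
  interpret positive_real_function \<phi> using assms by (rule admissible_positive)
  assume "\<forall>\<psi>\<in>admissible l. rho_hat \<psi> \<le> rho_hat \<phi>"
  then have "ereal inv_nome \<le> rho_hat \<phi>" using Phi_real_admissible rho_hat_Phi_real by metis
  then show "ereal inv_nome \<le> rho_A \<phi> \<and> (\<forall>u\<in>E. continuation \<phi> u = Phi l u)"
    using large_rho_hat_imp[OF assms] rho_hat_props(2) order_trans by blast
next
  assume "ereal inv_nome \<le> rho_A \<phi> \<and> (\<forall>u\<in>E. continuation \<phi> u = Phi l u)"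
  then have "rho_hat \<phi> = ereal inv_nome" using continuation_eq_Phi_imp[OF assms] by blast
  then show "\<forall>\<psi>\<in>admissible l. rho_hat \<psi> \<le> rho_hat \<phi>" using rho_hat_le by simp
qed

end

theorem theorem3p14:
  fixes r k q :: real
  assumes "0 < r" and "r < 1"
    and "k = sqrt (1 - r\<^sup>2)"
    and "q = exp (- pi * ellipK r / ellipK k)"
  shows "(\<forall>x\<in>{-1..1}. Phi r (of_real x) = of_real (Phi_real r x))
    \<and> Phi_real r \<in> admissible r
    \<and> (\<forall>\<psi>\<in>admissible r. rho_hat \<psi> \<le> rho_hat (Phi_real r))
    \<and> (\<forall>\<phi>\<in>admissible r.
        (\<forall>\<psi>\<in>admissible r. rho_hat \<psi> \<le> rho_hat \<phi>) \<longleftrightarrow>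
        (ereal (inverse q) \<le> rho_A \<phi> \<and>
         (\<forall>u\<in>bernstein_ellipse (ereal (inverse q)). continuation \<phi> u = Phi r u)))
    \<and> rho_hat (Phi_real r) = rho_A (Phi_real r)
    \<and> rho_A (Phi_real r) = ereal (inverse q)
    \<and> inverse q = exp (pi * ellipK r / ellipK k)
    \<and> exp (pi * ellipK r / ellipK k) = exp (pi * ellipK r / ellipK (sqrt (1 - r\<^sup>2)))"
proof -
  have r2: "r\<^sup>2 < 1" using assms by (simp add: power_less_one_iff abs_square_less_1)
  interpret complementary_moduli k r
    by unfold_locales (use assms r2 in auto)
  have q: "inverse q = inv_nome"
    by (simp add: assms(4) inv_nome_def period_ratio_def exp_minus mult.commute)
  have "inverse q = exp (pi * ellipK r / ellipK k)"
    by (simp add: assms(4) exp_minus)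
  then show ?thesis
    unfolding q
    using Phi_of_real_eq Phi_real_admissible rho_hat_le rho_hat_Phi_real maximal_iff rho_A_Phi_real
    by (simp add: assms(3))
qed

end
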